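(* Let $\mathcal C$ be a BD category, that is, a category with bifunctors $\oplus,\otimes$, objects $0,1$ and natural isomorphisms $\alpha^\oplus,\lambda^\oplus,\rho^\oplus,\gamma^\oplus,\alpha^\otimes,\lambda^\otimes,\rho^\otimes,\gamma^\otimes,\delta,\varepsilon$ satisfying the BD axioms (1)--(18) listed in the context. Define, for all objects $A,B,C$, $$\delta^\#_{A,B,C}=\gamma^\otimes_{A\oplus B,C};\delta_{C,A,B};(\gamma^\otimes_{A,C}\oplus\gamma^\otimes_{B,C})^{-1}:(A\oplus B)\otimes C\to (A\otimes C)\oplus(B\otimes C),$$ $$\lambda^*_A=\gamma^\otimes_{0,A};\varepsilon_A:0\otimes A\to 0,\qquad \rho^*_A=\varepsilon_A:A\otimes 0\to 0 .$$ Then all 24 of Laplaza's coherence conditions (in their isomorphism-bound versions) hold; that is, for all objects $A,B,C,D$ of $\mathcal C$ (writing $XY$ for $X\otimes Y$): (I) $\delta_{A,B,C}=(1_A\otimes\gamma^\oplus_{B,C});\delta_{A,C,B};\gamma^\oplus_{AC,AB}$. (II) $\delta^\#_{A,B,C};(\gamma^\otimes_{A,C}\oplus\gamma^\otimes_{B,C})=\gamma^\otimes_{A\oplus B,C};\delta_{C,A,B}$. (III) $\delta^\#_{A,B,C};\gamma^\oplus_{AC,BC}=(\gamma^\oplus_{A,B}\otimes 1_C);\delta^\#_{B,A,C}$. (IV) $(\alpha^\oplus_{A,B,C}\otimes 1_D);\delta^\#_{A,B\oplus C,D};(1_{AD}\oplus\delta^\#_{B,C,D})=\delta^\#_{A\oplus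 B,C,D};(\delta^\#_{A,B,D}\oplus 1_{CD});\alpha^\oplus_{AD,BD,CD}$. (V) $(1_A\otimes\alpha^\oplus_{B,C,D});\delta_{A,B,C\oplus D};(1_{AB}\oplus\delta_{A,C,D})=\delta_{A,B\oplus C,D};(\delta_{A,B,C}\oplus 1_{AD});\alpha^\oplus_{AB,AC,AD}$. (VI) $\alpha^\otimes_{A,B,C\oplus D};(1_A\otimes\delta_{B,C,D});\delta_{A,BC,BD}=\delta_{AB,C,D};(\alpha^\otimes_{A,B,C}\oplus\alpha^\otimes_{A,B,D})$. (VII) $(\delta^\#_{A,B,C}\otimes 1_D);\delta^\#_{AC,BC,D};(\alpha^\otimes_{A,C,D}\oplus\alpha^\otimes_{B,C,D})=\alpha^\otimes_{A\oplus B,C,D};\delta^\#_{A,B,CD}$. (VIII) $(\delta_{A,B,C}\otimes 1_D);\delta^\#_{AB,AC,D};(\alpha^\otimes_{A,B,D}\oplus\alpha^\otimes_{A,C,D})=\alpha^\otimes_{A,B\oplus C,D};(1_A\otimes\delta^\#_{B,C,D});\delta_{A,BD,CD}$. (IX) $\delta^\#_{A,B,C\oplus D};(\delta_{A,C,D}\oplus\delta_{B,C,D});\sigma_{A,B,C,D}=\delta_{A\oplus B,C,D};(\delta^\#_{A,B,C}\oplus\delta^\#_{A,B,D})$, with $\sigma$ as defined in the context. (X) $\lambda^*_0=\rho^*_0$. (XI) $\delta_{0,A,B};(\lambda^*_A\oplus\lambda^*_B);\lambda^\oplus_0=\lambda^*_{A\oplus B}$. (XII) $\delta^\#_{A,B,0};(\rho^*_A\oplus\rho^*_B);\lambda^\oplus_0=\rho^*_{A\oplus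 B}$. (XIII) $\rho^\otimes_0=\lambda^*_1$. (XIV) $\lambda^\otimes_0=\rho^*_1$. (XV) $\lambda^*_A=\gamma^\otimes_{0,A};\rho^*_A$. (XVI) $(\lambda^*_A\otimes 1_B);\lambda^*_B=\alpha^\otimes_{0,A,B};\lambda^*_{AB}$. (XVII) $(\rho^*_A\otimes 1_B);\lambda^*_B=\alpha^\otimes_{A,0,B};(1_A\otimes\lambda^*_B);\rho^*_A$. (XVIII) $\rho^*_{AB}=\alpha^\otimes_{A,B,0};(1_A\otimes\rho^*_B);\rho^*_A$. (XIX) $\delta_{A,0,B};(\rho^*_A\oplus 1_{AB});\lambda^\oplus_{AB}=1_A\otimes\lambda^\oplus_B$. (XX) $\delta^\#_{0,B,A};(\lambda^*_A\oplus 1_{BA});\lambda^\oplus_{BA}=\lambda^\oplus_B\otimes 1_A$. (XXI) $\delta_{A,B,0};(1_{AB}\oplus\rho^*_A);\rho^\oplus_{AB}=1_A\otimes\rho^\oplus_B$. (XXII) $\delta^\#_{A,0,B};(1_{AB}\oplus\lambda^*_B);\rho^\oplus_{AB}=\rho^\oplus_A\otimes 1_B$. (XXIII) $\delta_{1,A,B};(\lambda^\otimes_A\oplus\lambda^\otimes_B)=\lambda^\otimes_{A\oplus B}$. (XXIV) $\delta^\#_{A,B,1};(\rho^\otimes_A\oplus\rho^\otimes_B)=\rho^\otimes_{A\oplus B}$.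
   Context: Composition is written left to right: $f;g$ means first $f$, then $g$. $XY$ abbreviates $X\otimes Y$, and $\otimes$ binds more tightly than $\oplus$. A BD category is a category $\mathcal C$ with bifunctors $\oplus,\otimes:\mathcal C\times\mathcal C\to\mathcal C$, distinguished objects $0,1$, and isomorphisms, natural in all variable objects, $\alpha^\oplus_{A,B,C}:(A\oplus B)\oplus C\to A\oplus(B\oplus C)$, $\lambda^\oplus_A:0\oplus A\to A$, $\rho^\oplus_A:A\oplus 0\to A$, $\gamma^\oplus_{A,B}:A\oplus B\to B\oplus A$, $\alpha^\otimes_{A,B,C}:(A\otimes B)\otimes C\to A\otimes(B\otimes C)$, $\lambda^\otimes_A:1\otimes A\to A$, $\rho^\otimes_A:A\otimes 1\to A$, $\gamma^\otimes_{A,B}:A\otimes B\to B\otimes A$, $\delta_{A,B,C}:A\otimes(B\oplus C)\to(A\otimes B)\oplus(A\otimes C)$, $\varepsilon_A:A\otimes 0\to 0$, subject to the following BD axioms, for all objects $A,B,C,D$. ($\gamma^\otimes$ is not assumed to be a symmetry.) Notation: $\beta_{X,Y}=\gamma^\otimes_{X,Y};\gamma^\otimes_{Y,X}:X\otimes Y\to X\otimes Y$, and $$\sigma_{A,B,C,D}=(\alpha^\oplus_{AC\oplus AD,BC,BD})^{-1};(\alpha^\oplus_{AC,AD,BC}\oplus 1_{BD});\big((1_{AC}\oplus\gamma^\oplus_{BC,AD})\oplus 1_{BD}\big)^{-1};(\alpha^\oplus_{AC,BC,AD}\oplus 1_{BD})^{-1};\alpha^\oplus_{AC\oplus BC,AD,BD},$$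 an isomorphism $(AC\oplus AD)\oplus(BC\oplus BD)\to(AC\oplus BC)\oplus(AD\oplus BD)$. (1) $\alpha^\oplus_{A\oplus B,C,D};\alpha^\oplus_{A,B,C\oplus D}=(\alpha^\oplus_{A,B,C}\oplus 1_D);\alpha^\oplus_{A,B\oplus C,D};(1_A\oplus\alpha^\oplus_{B,C,D})$. (2) $\alpha^\oplus_{A,B,C};\gamma^\oplus_{A,B\oplus C};\alpha^\oplus_{B,C,A}=(\gamma^\oplus_{A,B}\oplus 1_C);\alpha^\oplus_{B,A,C};(1_B\oplus\gamma^\oplus_{A,C})$. (3) $\alpha^\oplus_{A,0,B};(1_A\oplus\lambda^\oplus_B)=\rho^\oplus_A\oplus 1_B$. (4) $\gamma^\oplus_{A,B};\gamma^\oplus_{B,A}=1_{A\oplus B}$. (5) $\alpha^\otimes_{AB,C,D};\alpha^\otimes_{A,B,CD}=(\alpha^\otimes_{A,B,C}\otimes 1_D);\alpha^\otimes_{A,BC,D};(1_A\otimes\alpha^\otimes_{B,C,D})$. (6) $\alpha^\otimes_{A,B,C};\gamma^\otimes_{A,BC};\alpha^\otimes_{B,C,A}=(\gamma^\otimes_{A,B}\otimes 1_C);\alpha^\otimes_{B,A,C};(1_B\otimes\gamma^\otimes_{A,C})$. (7) $\alpha^\otimes_{A,B,C};(\gamma^\otimes_{BC,A})^{-1};\alpha^\otimes_{B,C,A}=((\gamma^\otimes_{B,A})^{-1}\otimes 1_C);\alpha^\otimes_{B,A,C};(1_B\otimes(\gamma^\otimes_{C,A})^{-1})$. (8) $\alpha^\otimes_{A,1,B};(1_A\otimes\lambda^\otimes_B)=\rho^\otimes_A\otimes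 1_B$. (9) $\delta_{A,B,C};(\beta_{A,B}\oplus\beta_{A,C})=\beta_{A,B\oplus C};\delta_{A,B,C}$, and $\beta_{A,0}=1_{A\otimes 0}$. (10) $\delta_{A,B,C}=(1_A\otimes\gamma^\oplus_{B,C});\delta_{A,C,B};\gamma^\oplus_{AC,AB}$. (11) $(1_A\otimes\alpha^\oplus_{B,C,D});\delta_{A,B,C\oplus D};(1_{AB}\oplus\delta_{A,C,D})=\delta_{A,B\oplus C,D};(\delta_{A,B,C}\oplus 1_{AD});\alpha^\oplus_{AB,AC,AD}$. (12) $\delta_{A,B,0};(1_{AB}\oplus\varepsilon_A);\rho^\oplus_{AB}=1_A\otimes\rho^\oplus_B$. (13) $\alpha^\otimes_{A,B,C\oplus D};(1_A\otimes\delta_{B,C,D});\delta_{A,BC,BD}=\delta_{AB,C,D};(\alpha^\otimes_{A,B,C}\oplus\alpha^\otimes_{A,B,D})$. (14) $\varepsilon_{AB}=\alpha^\otimes_{A,B,0};(1_A\otimes\varepsilon_B);\varepsilon_A$. (15) $\delta_{1,A,B};(\lambda^\otimes_A\oplus\lambda^\otimes_B)=\lambda^\otimes_{A\oplus B}$. (16) $\varepsilon_1=\lambda^\otimes_0$. (17) $\gamma^\otimes_{A\oplus B,C\oplus D};\delta_{C\oplus D,A,B};(\gamma^\otimes_{A,C\oplus D}\oplus\gamma^\otimes_{B,C\oplus D})^{-1};(\delta_{A,C,D}\oplus\delta_{B,C,D});\sigma_{A,B,C,D}=\delta_{A\oplus B,C,D};(\gamma^\otimes_{A\oplus B,C}\oplus\gamma^\otimes_{A\oplus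 B,D});(\delta_{C,A,B}\oplus\delta_{D,A,B});\big((\gamma^\otimes_{A,C}\oplus\gamma^\otimes_{B,C})\oplus(\gamma^\otimes_{A,D}\oplus\gamma^\otimes_{B,D})\big)^{-1}$. (18) $\varepsilon_{A\oplus B}=\gamma^\otimes_{A\oplus B,0};\delta_{0,A,B};(\gamma^\otimes_{A,0}\oplus\gamma^\otimes_{B,0})^{-1};(\varepsilon_A\oplus\varepsilon_B);\lambda^\oplus_0$, and $\gamma^\otimes_{0,0}=1_{0\otimes 0}$. *)

theory Defs
  imports Main
begin

record ('o, 'm) cat =
  Obj :: "'o set"
  Arr :: "'m set"
  Dom :: "'m \<Rightarrow> 'o"
  Cod :: "'m \<Rightarrow> 'o"
  ident :: "'o \<Rightarrow> 'm" ("\<iota>\<index>")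
  compose :: "'m \<Rightarrow> 'm \<Rightarrow> 'm" (infixl "\<Zsemi>\<index>" 55)

definition hom :: "('o, 'm, 'x) cat_scheme \<Rightarrow> 'o \<Rightarrow> 'o \<Rightarrow> 'm set" where
  "hom \<C> A B = {f \<in> Arr \<C>. Dom \<C> f = A \<and> Cod \<C> f = B}"

definition isos :: "('o, 'm, 'x) cat_scheme \<Rightarrow> 'o \<Rightarrow> 'o \<Rightarrow> 'm set" where
  "isos \<C> A B = {f \<in> hom \<C> A B. \<exists>g \<in> hom \<C> B A.
     f \<Zsemi>\<^bsub>\<C>\<^esub> g = \<iota>\<^bsub>\<C>\<^esub> A \<and> g \<Zsemi>\<^bsub>\<C>\<^esub> f = \<iota>\<^bsub>\<C>\<^esub> B}"

definition inv_arr :: "('o, 'm, 'x) cat_scheme \<Rightarrow> 'm \<Rightarrow> 'm" ("inv\<index> _" [81] 80) where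
  "inv\<^bsub>\<C>\<^esub> f = (THE g. g \<in> hom \<C> (Cod \<C> f) (Dom \<C> f) \<and>
     f \<Zsemi>\<^bsub>\<C>\<^esub> g = \<iota>\<^bsub>\<C>\<^esub> (Dom \<C> f) \<and> g \<Zsemi>\<^bsub>\<C>\<^esub> f = \<iota>\<^bsub>\<C>\<^esub> (Cod \<C> f))"

text \<open>Composition is in diagrammatic order.\<close>

locale category =
  fixes \<C> :: "('o, 'm, 'x) cat_scheme" (structure)
  assumes dom_obj: "f \<in> Arr \<C> \<Longrightarrow> Dom \<C> f \<in> Obj \<C>"
    and cod_obj: "f \<in> Arr \<C> \<Longrightarrow> Cod \<C> f \<in> Obj \<C>"
    and ident_hom: "A \<in> Obj \<C> \<Longrightarrow> \<iota> A \<in> hom \<C> A A"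
    and compose_hom: "\<lbrakk>f \<in> hom \<C> A B; g \<in> hom \<C> B C\<rbrakk> \<Longrightarrow> f \<Zsemi> g \<in> hom \<C> A C"
    and ident_left: "f \<in> hom \<C> A B \<Longrightarrow> \<iota> A \<Zsemi> f = f"
    and ident_right: "f \<in> hom \<C> A B \<Longrightarrow> f \<Zsemi> \<iota> B = f"
    and compose_assoc: "\<lbrakk>f \<in> hom \<C> A B; g \<in> hom \<C> B C; h \<in> hom \<C> C D\<rbrakk> \<Longrightarrow>
      (f \<Zsemi> g) \<Zsemi> h = f \<Zsemi> (g \<Zsemi> h)"

definition bifunctor ::
  "('o, 'm, 'x) cat_scheme \<Rightarrow> ('o \<Rightarrow> 'o \<Rightarrow> 'o) \<Rightarrow> ('m \<Rightarrow> 'm \<Rightarrow> 'm) \<Rightarrow> bool" where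
  "bifunctor \<C> F\<^sub>o F\<^sub>a \<longleftrightarrow>
     (\<forall>A \<in> Obj \<C>. \<forall>B \<in> Obj \<C>. F\<^sub>o A B \<in> Obj \<C>) \<and>
     (\<forall>A B A' B' f g. f \<in> hom \<C> A A' \<longrightarrow> g \<in> hom \<C> B B' \<longrightarrow>
        F\<^sub>a f g \<in> hom \<C> (F\<^sub>o A B) (F\<^sub>o A' B')) \<and>
     (\<forall>A \<in> Obj \<C>. \<forall>B \<in> Obj \<C>. F\<^sub>a (\<iota>\<^bsub>\<C>\<^esub> A) (\<iota>\<^bsub>\<C>\<^esub> B) = \<iota>\<^bsub>\<C>\<^esub> (F\<^sub>o A B)) \<and>
     (\<forall>A A' A'' B B' B'' f f' g g'.
        f \<in> hom \<C> A A' \<longrightarrow> f' \<in> hom \<C> A' A'' \<longrightarrow> g \<in> hom \<C> B B' \<longrightarrow> g' \<in> hom \<C> B' B'' \<longrightarrow>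
        F\<^sub>a (f \<Zsemi>\<^bsub>\<C>\<^esub> f') (g \<Zsemi>\<^bsub>\<C>\<^esub> g') = F\<^sub>a f g \<Zsemi>\<^bsub>\<C>\<^esub> F\<^sub>a f' g')"

text \<open>
  The bifunctors are written \<open>\<oplus>\<close>, \<open>\<otimes>\<close> on objects and \<open>\<boxplus>\<close>, \<open>\<boxtimes>\<close> on arrows.
\<close>

record ('o, 'm) bd_cat = "('o, 'm) cat" +
  sum_obj :: "'o \<Rightarrow> 'o \<Rightarrow> 'o" (infixl "\<oplus>\<index>" 65)
  sum_arr :: "'m \<Rightarrow> 'm \<Rightarrow> 'm" (infixl "\<boxplus>\<index>" 65)
  tensor_obj :: "'o \<Rightarrow> 'o \<Rightarrow> 'o" (infixl "\<otimes>\<index>" 70)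
  tensor_arr :: "'m \<Rightarrow> 'm \<Rightarrow> 'm" (infixl "\<boxtimes>\<index>" 70)
  zero_obj :: 'o ("\<zero>\<index>")
  one_obj :: 'o ("\<one>\<index>")
  sum_assoc :: "'o \<Rightarrow> 'o \<Rightarrow> 'o \<Rightarrow> 'm" ("\<alpha>\<^sup>\<oplus>\<index>")
  sum_left_unit :: "'o \<Rightarrow> 'm" ("\<lambda>\<^sup>\<oplus>\<index>")
  sum_right_unit :: "'o \<Rightarrow> 'm" ("\<rho>\<^sup>\<oplus>\<index>")
  sum_swap :: "'o \<Rightarrow> 'o \<Rightarrow> 'm" ("\<gamma>\<^sup>\<oplus>\<index>")
  tensor_assoc :: "'o \<Rightarrow> 'o \<Rightarrow> 'o \<Rightarrow> 'm" ("\<alpha>\<^sup>\<otimes>\<index>")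
  tensor_left_unit :: "'o \<Rightarrow> 'm" ("\<lambda>\<^sup>\<otimes>\<index>")
  tensor_right_unit :: "'o \<Rightarrow> 'm" ("\<rho>\<^sup>\<otimes>\<index>")
  tensor_swap :: "'o \<Rightarrow> 'o \<Rightarrow> 'm" ("\<gamma>\<^sup>\<otimes>\<index>")
  distrib :: "'o \<Rightarrow> 'o \<Rightarrow> 'o \<Rightarrow> 'm" ("\<delta>\<index>")
  annih :: "'o \<Rightarrow> 'm" ("\<epsilon>\<index>")

locale bd_structure = category \<C>
  for \<C> :: "('o, 'm, 'x) bd_cat_scheme" (structure) +
  assumes sum_bifunctor: "bifunctor \<C> (\<oplus>) (\<boxplus>)"
    and tensor_bifunctor: "bifunctor \<C> (\<otimes>) (\<boxtimes>)"
    and zero_obj: "\<zero> \<in> Obj \<C>"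
    and one_obj: "\<one> \<in> Obj \<C>"
    and sum_assoc_iso: "\<lbrakk>A \<in> Obj \<C>; B \<in> Obj \<C>; C \<in> Obj \<C>\<rbrakk> \<Longrightarrow>
      \<alpha>\<^sup>\<oplus> A B C \<in> isos \<C> ((A \<oplus> B) \<oplus> C) (A \<oplus> (B \<oplus> C))"
    and sum_assoc_nat: "\<lbrakk>f \<in> hom \<C> A A'; g \<in> hom \<C> B B'; h \<in> hom \<C> C C'\<rbrakk> \<Longrightarrow>
      ((f \<boxplus> g) \<boxplus> h) \<Zsemi> \<alpha>\<^sup>\<oplus> A' B' C' = \<alpha>\<^sup>\<oplus> A B C \<Zsemi> (f \<boxplus> (g \<boxplus> h))"
    and sum_left_unit_iso: "A \<in> Obj \<C> \<Longrightarrow> \<lambda>\<^sup>\<oplus> A \<in> isos \<C> (\<zero> \<oplus> A) A"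
    and sum_left_unit_nat: "f \<in> hom \<C> A A' \<Longrightarrow> (\<iota> \<zero> \<boxplus> f) \<Zsemi> \<lambda>\<^sup>\<oplus> A' = \<lambda>\<^sup>\<oplus> A \<Zsemi> f"
    and sum_right_unit_iso: "A \<in> Obj \<C> \<Longrightarrow> \<rho>\<^sup>\<oplus> A \<in> isos \<C> (A \<oplus> \<zero>) A"
    and sum_right_unit_nat: "f \<in> hom \<C> A A' \<Longrightarrow> (f \<boxplus> \<iota> \<zero>) \<Zsemi> \<rho>\<^sup>\<oplus> A' = \<rho>\<^sup>\<oplus> A \<Zsemi> f"
    and sum_swap_iso: "\<lbrakk>A \<in> Obj \<C>; B \<in> Obj \<C>\<rbrakk> \<Longrightarrow> \<gamma>\<^sup>\<oplus> A B \<in> isos \<C> (A \<oplus> B) (B \<oplus> A)"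
    and sum_swap_nat: "\<lbrakk>f \<in> hom \<C> A A'; g \<in> hom \<C> B B'\<rbrakk> \<Longrightarrow>
      (f \<boxplus> g) \<Zsemi> \<gamma>\<^sup>\<oplus> A' B' = \<gamma>\<^sup>\<oplus> A B \<Zsemi> (g \<boxplus> f)"
    and tensor_assoc_iso: "\<lbrakk>A \<in> Obj \<C>; B \<in> Obj \<C>; C \<in> Obj \<C>\<rbrakk> \<Longrightarrow>
      \<alpha>\<^sup>\<otimes> A B C \<in> isos \<C> ((A \<otimes> B) \<otimes> C) (A \<otimes> (B \<otimes> C))"
    and tensor_assoc_nat: "\<lbrakk>f \<in> hom \<C> A A'; g \<in> hom \<C> B B'; h \<in> hom \<C> C C'\<rbrakk> \<Longrightarrow>
      ((f \<boxtimes> g) \<boxtimes> h) \<Zsemi> \<alpha>\<^sup>\<otimes> A' B' C' = \<alpha>\<^sup>\<otimes> A B C \<Zsemi> (f \<boxtimes> (g \<boxtimes> h))"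
    and tensor_left_unit_iso: "A \<in> Obj \<C> \<Longrightarrow> \<lambda>\<^sup>\<otimes> A \<in> isos \<C> (\<one> \<otimes> A) A"
    and tensor_left_unit_nat: "f \<in> hom \<C> A A' \<Longrightarrow> (\<iota> \<one> \<boxtimes> f) \<Zsemi> \<lambda>\<^sup>\<otimes> A' = \<lambda>\<^sup>\<otimes> A \<Zsemi> f"
    and tensor_right_unit_iso: "A \<in> Obj \<C> \<Longrightarrow> \<rho>\<^sup>\<otimes> A \<in> isos \<C> (A \<otimes> \<one>) A"
    and tensor_right_unit_nat: "f \<in> hom \<C> A A' \<Longrightarrow> (f \<boxtimes> \<iota> \<one>) \<Zsemi> \<rho>\<^sup>\<otimes> A' = \<rho>\<^sup>\<otimes> A \<Zsemi> f"
    and tensor_swap_iso: "\<lbrakk>A \<in> Obj \<C>; B \<in> Obj \<C>\<rbrakk> \<Longrightarrow> \<gamma>\<^sup>\<otimes> A B \<in> isos \<C> (A \<otimes> B) (B \<otimes> A)"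
    and tensor_swap_nat: "\<lbrakk>f \<in> hom \<C> A A'; g \<in> hom \<C> B B'\<rbrakk> \<Longrightarrow>
      (f \<boxtimes> g) \<Zsemi> \<gamma>\<^sup>\<otimes> A' B' = \<gamma>\<^sup>\<otimes> A B \<Zsemi> (g \<boxtimes> f)"
    and distrib_iso: "\<lbrakk>A \<in> Obj \<C>; B \<in> Obj \<C>; C \<in> Obj \<C>\<rbrakk> \<Longrightarrow>
      \<delta> A B C \<in> isos \<C> (A \<otimes> (B \<oplus> C)) (A \<otimes> B \<oplus> A \<otimes> C)"
    and distrib_nat: "\<lbrakk>f \<in> hom \<C> A A'; g \<in> hom \<C> B B'; h \<in> hom \<C> C C'\<rbrakk> \<Longrightarrow>
      (f \<boxtimes> (g \<boxplus> h)) \<Zsemi> \<delta> A' B' C' = \<delta> A B C \<Zsemi> (f \<boxtimes> g \<boxplus> f \<boxtimes> h)"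
    and annih_iso: "A \<in> Obj \<C> \<Longrightarrow> \<epsilon> A \<in> isos \<C> (A \<otimes> \<zero>) \<zero>"
    and annih_nat: "f \<in> hom \<C> A A' \<Longrightarrow> (f \<boxtimes> \<iota> \<zero>) \<Zsemi> \<epsilon> A' = \<epsilon> A \<Zsemi> \<iota> \<zero>"

definition double_swap :: "('o, 'm, 'x) bd_cat_scheme \<Rightarrow> 'o \<Rightarrow> 'o \<Rightarrow> 'm" ("\<beta>\<index>") where
  "\<beta> X Y = \<gamma>\<^sup>\<otimes> X Y \<Zsemi> \<gamma>\<^sup>\<otimes> Y X"
  for \<C> (structure)

definition interchange ::
  "('o, 'm, 'x) bd_cat_scheme \<Rightarrow> 'o \<Rightarrow> 'o \<Rightarrow> 'o \<Rightarrow> 'o \<Rightarrow> 'm" ("\<sigma>\<index>") where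
  "\<sigma> A B C D =
     inv (\<alpha>\<^sup>\<oplus> (A \<otimes> C \<oplus> A \<otimes> D) (B \<otimes> C) (B \<otimes> D))
     \<Zsemi> (\<alpha>\<^sup>\<oplus> (A \<otimes> C) (A \<otimes> D) (B \<otimes> C) \<boxplus> \<iota> (B \<otimes> D))
     \<Zsemi> inv ((\<iota> (A \<otimes> C) \<boxplus> \<gamma>\<^sup>\<oplus> (B \<otimes> C) (A \<otimes> D)) \<boxplus> \<iota> (B \<otimes> D))
     \<Zsemi> inv (\<alpha>\<^sup>\<oplus> (A \<otimes> C) (B \<otimes> C) (A \<otimes> D) \<boxplus> \<iota> (B \<otimes> D))
     \<Zsemi> \<alpha>\<^sup>\<oplus> (A \<otimes> C \<oplus> B \<otimes> C) (A \<otimes> D) (B \<otimes> D)"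
  for \<C> (structure)

text \<open>The tensor swap is a braiding, not assumed to be a symmetry.\<close>

locale bd_category = bd_structure \<C>
  for \<C> :: "('o, 'm, 'x) bd_cat_scheme" (structure) +
  assumes sum_pentagon: "\<lbrakk>A \<in> Obj \<C>; B \<in> Obj \<C>; C \<in> Obj \<C>; D \<in> Obj \<C>\<rbrakk> \<Longrightarrow>
      \<alpha>\<^sup>\<oplus> (A \<oplus> B) C D \<Zsemi> \<alpha>\<^sup>\<oplus> A B (C \<oplus> D)
        = (\<alpha>\<^sup>\<oplus> A B C \<boxplus> \<iota> D) \<Zsemi> \<alpha>\<^sup>\<oplus> A (B \<oplus> C) D \<Zsemi> (\<iota> A \<boxplus> \<alpha>\<^sup>\<oplus> B C D)"
    and sum_hexagon: "\<lbrakk>A \<in> Obj \<C>; B \<in> Obj \<C>; C \<in> Obj \<C>\<rbrakk> \<Longrightarrow>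
      \<alpha>\<^sup>\<oplus> A B C \<Zsemi> \<gamma>\<^sup>\<oplus> A (B \<oplus> C) \<Zsemi> \<alpha>\<^sup>\<oplus> B C A
        = (\<gamma>\<^sup>\<oplus> A B \<boxplus> \<iota> C) \<Zsemi> \<alpha>\<^sup>\<oplus> B A C \<Zsemi> (\<iota> B \<boxplus> \<gamma>\<^sup>\<oplus> A C)"
    and sum_triangle: "\<lbrakk>A \<in> Obj \<C>; B \<in> Obj \<C>\<rbrakk> \<Longrightarrow>
      \<alpha>\<^sup>\<oplus> A \<zero> B \<Zsemi> (\<iota> A \<boxplus> \<lambda>\<^sup>\<oplus> B) = \<rho>\<^sup>\<oplus> A \<boxplus> \<iota> B"
    and sum_symmetry: "\<lbrakk>A \<in> Obj \<C>; B \<in> Obj \<C>\<rbrakk> \<Longrightarrow>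
      \<gamma>\<^sup>\<oplus> A B \<Zsemi> \<gamma>\<^sup>\<oplus> B A = \<iota> (A \<oplus> B)"
    and tensor_pentagon: "\<lbrakk>A \<in> Obj \<C>; B \<in> Obj \<C>; C \<in> Obj \<C>; D \<in> Obj \<C>\<rbrakk> \<Longrightarrow>
      \<alpha>\<^sup>\<otimes> (A \<otimes> B) C D \<Zsemi> \<alpha>\<^sup>\<otimes> A B (C \<otimes> D)
        = (\<alpha>\<^sup>\<otimes> A B C \<boxtimes> \<iota> D) \<Zsemi> \<alpha>\<^sup>\<otimes> A (B \<otimes> C) D \<Zsemi> (\<iota> A \<boxtimes> \<alpha>\<^sup>\<otimes> B C D)"
    and tensor_hexagon: "\<lbrakk>A \<in> Obj \<C>; B \<in> Obj \<C>; C \<in> Obj \<C>\<rbrakk> \<Longrightarrow>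
      \<alpha>\<^sup>\<otimes> A B C \<Zsemi> \<gamma>\<^sup>\<otimes> A (B \<otimes> C) \<Zsemi> \<alpha>\<^sup>\<otimes> B C A
        = (\<gamma>\<^sup>\<otimes> A B \<boxtimes> \<iota> C) \<Zsemi> \<alpha>\<^sup>\<otimes> B A C \<Zsemi> (\<iota> B \<boxtimes> \<gamma>\<^sup>\<otimes> A C)"
    and tensor_hexagon_inv: "\<lbrakk>A \<in> Obj \<C>; B \<in> Obj \<C>; C \<in> Obj \<C>\<rbrakk> \<Longrightarrow>
      \<alpha>\<^sup>\<otimes> A B C \<Zsemi> inv (\<gamma>\<^sup>\<otimes> (B \<otimes> C) A) \<Zsemi> \<alpha>\<^sup>\<otimes> B C A
        = (inv (\<gamma>\<^sup>\<otimes> B A) \<boxtimes> \<iota> C) \<Zsemi> \<alpha>\<^sup>\<otimes> B A C \<Zsemi> (\<iota> B \<boxtimes> inv (\<gamma>\<^sup>\<otimes> C A))"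
    and tensor_triangle: "\<lbrakk>A \<in> Obj \<C>; B \<in> Obj \<C>\<rbrakk> \<Longrightarrow>
      \<alpha>\<^sup>\<otimes> A \<one> B \<Zsemi> (\<iota> A \<boxtimes> \<lambda>\<^sup>\<otimes> B) = \<rho>\<^sup>\<otimes> A \<boxtimes> \<iota> B"
    and double_swap_distrib: "\<lbrakk>A \<in> Obj \<C>; B \<in> Obj \<C>; C \<in> Obj \<C>\<rbrakk> \<Longrightarrow>
      \<delta> A B C \<Zsemi> (\<beta> A B \<boxplus> \<beta> A C) = \<beta> A (B \<oplus> C) \<Zsemi> \<delta> A B C"
    and double_swap_zero: "A \<in> Obj \<C> \<Longrightarrow> \<beta> A \<zero> = \<iota> (A \<otimes> \<zero>)"
    and distrib_sum_swap: "\<lbrakk>A \<in> Obj \<C>; B \<in> Obj \<C>; C \<in> Obj \<C>\<rbrakk> \<Longrightarrow>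
      \<delta> A B C = (\<iota> A \<boxtimes> \<gamma>\<^sup>\<oplus> B C) \<Zsemi> \<delta> A C B \<Zsemi> \<gamma>\<^sup>\<oplus> (A \<otimes> C) (A \<otimes> B)"
    and distrib_sum_assoc: "\<lbrakk>A \<in> Obj \<C>; B \<in> Obj \<C>; C \<in> Obj \<C>; D \<in> Obj \<C>\<rbrakk> \<Longrightarrow>
      (\<iota> A \<boxtimes> \<alpha>\<^sup>\<oplus> B C D) \<Zsemi> \<delta> A B (C \<oplus> D) \<Zsemi> (\<iota> (A \<otimes> B) \<boxplus> \<delta> A C D)
        = \<delta> A (B \<oplus> C) D \<Zsemi> (\<delta> A B C \<boxplus> \<iota> (A \<otimes> D)) \<Zsemi> \<alpha>\<^sup>\<oplus> (A \<otimes> B) (A \<otimes> C) (A \<otimes> D)"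
    and distrib_sum_right_unit: "\<lbrakk>A \<in> Obj \<C>; B \<in> Obj \<C>\<rbrakk> \<Longrightarrow>
      \<delta> A B \<zero> \<Zsemi> (\<iota> (A \<otimes> B) \<boxplus> \<epsilon> A) \<Zsemi> \<rho>\<^sup>\<oplus> (A \<otimes> B) = \<iota> A \<boxtimes> \<rho>\<^sup>\<oplus> B"
    and distrib_tensor_assoc: "\<lbrakk>A \<in> Obj \<C>; B \<in> Obj \<C>; C \<in> Obj \<C>; D \<in> Obj \<C>\<rbrakk> \<Longrightarrow>
      \<alpha>\<^sup>\<otimes> A B (C \<oplus> D) \<Zsemi> (\<iota> A \<boxtimes> \<delta> B C D) \<Zsemi> \<delta> A (B \<otimes> C) (B \<otimes> D)
        = \<delta> (A \<otimes> B) C D \<Zsemi> (\<alpha>\<^sup>\<otimes> A B C \<boxplus> \<alpha>\<^sup>\<otimes> A B D)"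
    and annih_tensor: "\<lbrakk>A \<in> Obj \<C>; B \<in> Obj \<C>\<rbrakk> \<Longrightarrow>
      \<epsilon> (A \<otimes> B) = \<alpha>\<^sup>\<otimes> A B \<zero> \<Zsemi> (\<iota> A \<boxtimes> \<epsilon> B) \<Zsemi> \<epsilon> A"
    and distrib_one: "\<lbrakk>A \<in> Obj \<C>; B \<in> Obj \<C>\<rbrakk> \<Longrightarrow>
      \<delta> \<one> A B \<Zsemi> (\<lambda>\<^sup>\<otimes> A \<boxplus> \<lambda>\<^sup>\<otimes> B) = \<lambda>\<^sup>\<otimes> (A \<oplus> B)"
    and annih_one: "\<epsilon> \<one> = \<lambda>\<^sup>\<otimes> \<zero>"
    and distrib_distrib: "\<lbrakk>A \<in> Obj \<C>; B \<in> Obj \<C>; C \<in> Obj \<C>; D \<in> Obj \<C>\<rbrakk> \<Longrightarrow>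
      \<gamma>\<^sup>\<otimes> (A \<oplus> B) (C \<oplus> D) \<Zsemi> \<delta> (C \<oplus> D) A B
          \<Zsemi> inv (\<gamma>\<^sup>\<otimes> A (C \<oplus> D) \<boxplus> \<gamma>\<^sup>\<otimes> B (C \<oplus> D))
          \<Zsemi> (\<delta> A C D \<boxplus> \<delta> B C D) \<Zsemi> \<sigma> A B C D
        = \<delta> (A \<oplus> B) C D \<Zsemi> (\<gamma>\<^sup>\<otimes> (A \<oplus> B) C \<boxplus> \<gamma>\<^sup>\<otimes> (A \<oplus> B) D)
          \<Zsemi> (\<delta> C A B \<boxplus> \<delta> D A B)
          \<Zsemi> inv ((\<gamma>\<^sup>\<otimes> A C \<boxplus> \<gamma>\<^sup>\<otimes> B C) \<boxplus> (\<gamma>\<^sup>\<otimes> A D \<boxplus> \<gamma>\<^sup>\<otimes> B D))"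
    and annih_sum: "\<lbrakk>A \<in> Obj \<C>; B \<in> Obj \<C>\<rbrakk> \<Longrightarrow>
      \<epsilon> (A \<oplus> B) = \<gamma>\<^sup>\<otimes> (A \<oplus> B) \<zero> \<Zsemi> \<delta> \<zero> A B \<Zsemi> inv (\<gamma>\<^sup>\<otimes> A \<zero> \<boxplus> \<gamma>\<^sup>\<otimes> B \<zero>)
          \<Zsemi> (\<epsilon> A \<boxplus> \<epsilon> B) \<Zsemi> \<lambda>\<^sup>\<oplus> \<zero>"
    and tensor_swap_zero: "\<gamma>\<^sup>\<otimes> \<zero> \<zero> = \<iota> (\<zero> \<otimes> \<zero>)"

definition right_distrib :: "('o, 'm, 'x) bd_cat_scheme \<Rightarrow> 'o \<Rightarrow> 'o \<Rightarrow> 'o \<Rightarrow> 'm" ("\<delta>\<^sup>#\<index>") where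
  "\<delta>\<^sup># A B C = \<gamma>\<^sup>\<otimes> (A \<oplus> B) C \<Zsemi> \<delta> C A B \<Zsemi> inv (\<gamma>\<^sup>\<otimes> A C \<boxplus> \<gamma>\<^sup>\<otimes> B C)"
  for \<C> (structure)

definition left_annih :: "('o, 'm, 'x) bd_cat_scheme \<Rightarrow> 'o \<Rightarrow> 'm" ("\<lambda>\<^sup>*\<index>") where
  "\<lambda>\<^sup>* A = \<gamma>\<^sup>\<otimes> \<zero> A \<Zsemi> \<epsilon> A"
  for \<C> (structure)

definition right_annih :: "('o, 'm, 'x) bd_cat_scheme \<Rightarrow> 'o \<Rightarrow> 'm" ("\<rho>\<^sup>*\<index>") where
  "\<rho>\<^sup>* A = \<epsilon> A"
  for \<C> (structure)

end

theory Submission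
  imports Defs
begin

text \<open>
  Conditions on \<open>\<delta>\<^sup>#\<close> and \<open>\<lambda>\<^sup>*\<close> are transported along the braiding to conditions on \<open>\<delta>\<close> and \<open>\<epsilon>\<close>:
  composing with a sum of braidings removes every inverse from \<open>\<delta>\<^sup>#\<close>. The substantial cases are
  (VIII) and (XVII), where the second hexagon moves the last factor of a triple product to the
  front, so that (VI) and (XVIII) apply; then (VII) and (XVI) follow from them by the first
  hexagon. The unit conditions (XIII), (XIX) and (XXIV) rest on the compatibility of a braiding
  with the unit, which follows from one hexagon by Kelly's argument.
\<close>

text \<open>The tensor braiding is not a symmetry, so the inverse braidings in
  \<open>\<delta>\<^sup>#\<close> cannot be exchanged for braidings in the opposite direction. Each
  equation is instead completed by an isomorphism that absorbs them and is cancelled at the end. For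
  the two conditions that combine \<open>\<delta>\<^sup>#\<close> with the tensor associator a plain
  sum of braidings does not fit, because the summands end in reassociated products; there the
  completion is what remains of a braiding involving a product once an associator is split off.
  Against zero the braiding does act as a symmetry, and this is what makes
  \<open>\<lambda>\<^sup>*\<close> compatible with the inverse braidings in
  \<open>annih_sum\<close>. Kelly's argument is carried out in a locale with a single hexagon and no
  symmetry, so that one lemma serves both the sum and the tensor.\<close>

context category
begin

section \<open>Typing, inverses and cancellation in a category\<close>

lemma hom_iff: "f \<in> hom \<C> A B \<longleftrightarrow> f \<in> Arr \<C> \<and> Dom \<C> f = A \<and> Cod \<C> f = B"
  by (auto simp: hom_def)

text \<open>The side conditions of the rewrite rules below are stated with \<open>starts\<close> because it types
  a right-nested composite in linear time, whereas separate conditions on \<open>Arr\<close>, \<open>Dom\<close> and \<open>Cod\<close>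
  make the simplifier check every tail twice.\<close>

definition starts :: "'o \<Rightarrow> 'm \<Rightarrow> bool" where
  "starts A f \<longleftrightarrow> f \<in> Arr \<C> \<and> Dom \<C> f = A"

lemma comp_arr [simp]:
  assumes "f \<in> Arr \<C>" "starts (Cod \<C> f) g"
  shows "f \<Zsemi> g \<in> Arr \<C>" "Dom \<C> (f \<Zsemi> g) = Dom \<C> f" "Cod \<C> (f \<Zsemi> g) = Cod \<C> g"
    "starts X (f \<Zsemi> g) = starts X f"
  using compose_hom[of f "Dom \<C> f" "Cod \<C> f" g "Cod \<C> g"] assms by (auto simp: hom_iff starts_def)

lemma ident_arr [simp]:
  assumes "A \<in> Obj \<C>"
  shows "\<iota> A \<in> Arr \<C>" "Dom \<C> (\<iota> A) = A" "Cod \<C> (\<iota> A) = A" "starts X (\<iota> A) \<longleftrightarrow> X = A"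
  using ident_hom[OF assms] by (auto simp: hom_iff starts_def)

declare dom_obj [simp] cod_obj [simp]

lemma comp_ident [simp]:
  shows "starts A f \<Longrightarrow> \<iota> A \<Zsemi> f = f" "f \<in> Arr \<C> \<Longrightarrow> Cod \<C> f = B \<Longrightarrow> f \<Zsemi> \<iota> B = f"
  using ident_left[of f] ident_right[of f] by (auto simp: hom_iff starts_def)

lemma comp_assoc:
  assumes "f \<in> Arr \<C>" "starts (Cod \<C> f) g" "starts (Cod \<C> g) h"
  shows "(f \<Zsemi> g) \<Zsemi> h = f \<Zsemi> (g \<Zsemi> h)"
  using compose_assoc[of f "Dom \<C> f" "Dom \<C> g" g "Dom \<C> h" h "Cod \<C> h"] assms
  by (auto simp: hom_iff starts_def)

text \<open>Rewriting modulo associativity: all composites are kept right-associated, so an equation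
  between short composites has to be extended by an arbitrary tail \<open>z\<close>.\<close>

lemma reassoc:
  assumes "f \<Zsemi> g = e"
    and "f \<in> Arr \<C>" "starts (Cod \<C> f) g" "starts (Cod \<C> g) z"
  shows "f \<Zsemi> (g \<Zsemi> z) = e \<Zsemi> z"
  using assms by (auto simp: comp_assoc starts_def)

text \<open>The endpoints are read off from the arrow, so invertibility is a side condition without
  objects to instantiate.\<close>

definition is_iso :: "'m \<Rightarrow> bool" where
  "is_iso f \<longleftrightarrow> f \<in> isos \<C> (Dom \<C> f) (Cod \<C> f)"

text \<open>Turns the typing axiom of a structural isomorphism into simplification facts; the free
  \<open>X\<close> reduces \<open>starts\<close> to a comparison of objects.\<close>

lemma isosD:
  assumes "f \<in> isos \<C> A B"
  shows "is_iso f \<and> f \<in> Arr \<C> \<and> Dom \<C> f = A \<and> Cod \<C> f = B \<and> (starts X f \<longleftrightarrow> X = A)"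
  using assms by (auto simp: is_iso_def isos_def hom_iff starts_def)

lemma is_isoI:
  assumes "f \<in> Arr \<C>" "g \<in> Arr \<C>" "Dom \<C> g = Cod \<C> f" "Cod \<C> g = Dom \<C> f"
    and "f \<Zsemi> g = \<iota> (Dom \<C> f)" "g \<Zsemi> f = \<iota> (Cod \<C> f)"
  shows "is_iso f"
  using assms by (auto simp: is_iso_def isos_def hom_iff)

text \<open>\<open>inv\<close> is a definite description, so computing it needs uniqueness: for a
  second inverse \<open>h\<close>, the composite \<open>(g \<Zsemi> f) \<Zsemi> h\<close> is both
  \<open>g\<close> and \<open>h\<close>.\<close>

lemma inv_eqI:
  assumes "f \<in> Arr \<C>" "g \<in> Arr \<C>" "Dom \<C> g = Cod \<C> f" "Cod \<C> g = Dom \<C> f"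
    and "f \<Zsemi> g = \<iota> (Dom \<C> f)" "g \<Zsemi> f = \<iota> (Cod \<C> f)"
  shows "inv f = g"
  unfolding inv_arr_def
proof (rule the_equality)
  fix h assume h: "h \<in> hom \<C> (Cod \<C> f) (Dom \<C> f) \<and>
    f \<Zsemi> h = \<iota> (Dom \<C> f) \<and> h \<Zsemi> f = \<iota> (Cod \<C> f)"
  then have "(g \<Zsemi> f) \<Zsemi> h = g"
    using assms by (subst comp_assoc) (auto simp: hom_iff starts_def)
  then show "h = g" using assms h by (simp add: hom_iff starts_def)
qed (use assms in \<open>simp add: hom_iff\<close>)

lemma inv_arr_props [simp]:
  assumes "is_iso f"
  shows "inv f \<in> Arr \<C>" "Dom \<C> (inv f) = Cod \<C> f" "Cod \<C> (inv f) = Dom \<C> f"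
    "f \<Zsemi> inv f = \<iota> (Dom \<C> f)" "inv f \<Zsemi> f = \<iota> (Cod \<C> f)" "is_iso (inv f)"
    "starts X (inv f) \<longleftrightarrow> X = Cod \<C> f"
proof -
  obtain g where g: "f \<in> Arr \<C>" "g \<in> Arr \<C>" "Dom \<C> g = Cod \<C> f" "Cod \<C> g = Dom \<C> f"
    "f \<Zsemi> g = \<iota> (Dom \<C> f)" "g \<Zsemi> f = \<iota> (Cod \<C> f)"
    using assms by (auto simp: is_iso_def isos_def hom_iff)
  then show "inv f \<in> Arr \<C>" "Dom \<C> (inv f) = Cod \<C> f" "Cod \<C> (inv f) = Dom \<C> f"
    "f \<Zsemi> inv f = \<iota> (Dom \<C> f)" "inv f \<Zsemi> f = \<iota> (Cod \<C> f)" "is_iso (inv f)"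
    "starts X (inv f) \<longleftrightarrow> X = Cod \<C> f"
    by (auto simp: inv_eqI[OF g] starts_def intro: is_isoI)
qed

lemma is_iso_arr: "is_iso f \<Longrightarrow> f \<in> Arr \<C>"
  by (auto simp: is_iso_def isos_def hom_iff)

text \<open>The inverse laws under a tail: in a right-associated composite an arrow and its inverse
  form a subterm only when they come last.\<close>

lemma comp_inv_tail [simp]:
  assumes "is_iso f"
  shows "starts (Dom \<C> f) z \<Longrightarrow> f \<Zsemi> (inv f \<Zsemi> z) = z" "starts (Cod \<C> f) z \<Longrightarrow> inv f \<Zsemi> (f \<Zsemi> z) = z"
  using assms by (auto simp: is_iso_arr starts_def reassoc[of f "inv f"] reassoc[of "inv f" f])

lemma is_iso_ident [simp]: "A \<in> Obj \<C> \<Longrightarrow> is_iso (\<iota> A)"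
  by (rule is_isoI[of _ "\<iota> A"]) auto

lemma is_iso_comp [simp]:
  assumes "is_iso f" "is_iso g" "starts (Cod \<C> f) g"
  shows "is_iso (f \<Zsemi> g)"
  by (rule is_isoI[of _ "inv g \<Zsemi> inv f"]) (use assms in \<open>auto simp: is_iso_arr comp_assoc starts_def\<close>)

lemma iso_cancel_left:
  assumes "f \<Zsemi> g = f \<Zsemi> h"
    and "is_iso f" "starts (Cod \<C> f) g" "starts (Cod \<C> f) h"
  shows "g = h"
proof -
  have "inv f \<Zsemi> (f \<Zsemi> g) = inv f \<Zsemi> (f \<Zsemi> h)" using assms(1) by simp
  then show ?thesis using assms(2-) by simp
qed

lemma iso_cancel_right:
  assumes "g \<Zsemi> f = h \<Zsemi> f"
    and "is_iso f" "g \<in> Arr \<C>" "h \<in> Arr \<C>" "Cod \<C> g = Dom \<C> f" "Cod \<C> h = Dom \<C> f"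
  shows "g = h"
proof -
  have "(g \<Zsemi> f) \<Zsemi> inv f = (h \<Zsemi> f) \<Zsemi> inv f" using assms(1) by simp
  then show ?thesis using assms(2-) by (simp add: comp_assoc is_iso_arr starts_def)
qed

end

section \<open>Calculus of a bifunctor on arrows\<close>

locale bifunctor_category = category \<C>
  for \<C> :: "('o, 'm, 'x) cat_scheme" (structure) +
  fixes P :: "'o \<Rightarrow> 'o \<Rightarrow> 'o" (infixl "\<odot>" 70)
    and p :: "'m \<Rightarrow> 'm \<Rightarrow> 'm" (infixl "\<star>" 70)
  assumes is_bifunctor: "bifunctor \<C> (\<odot>) (\<star>)"
begin

lemma obj [simp]: "A \<in> Obj \<C> \<Longrightarrow> B \<in> Obj \<C> \<Longrightarrow> A \<odot> B \<in> Obj \<C>"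
  using is_bifunctor by (simp add: bifunctor_def)

lemma arr [simp]:
  assumes "f \<in> Arr \<C>" "g \<in> Arr \<C>"
  shows "f \<star> g \<in> Arr \<C>" "Dom \<C> (f \<star> g) = Dom \<C> f \<odot> Dom \<C> g" "Cod \<C> (f \<star> g) = Cod \<C> f \<odot> Cod \<C> g"
    "starts X (f \<star> g) \<longleftrightarrow> X = Dom \<C> f \<odot> Dom \<C> g"
proof -
  have "f \<in> hom \<C> (Dom \<C> f) (Cod \<C> f)" "g \<in> hom \<C> (Dom \<C> g) (Cod \<C> g)"
    using assms by (auto simp: hom_iff)
  then have "f \<star> g \<in> hom \<C> (Dom \<C> f \<odot> Dom \<C> g) (Cod \<C> f \<odot> Cod \<C> g)"
    using is_bifunctor unfolding bifunctor_def by blast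
  then show "f \<star> g \<in> Arr \<C>" "Dom \<C> (f \<star> g) = Dom \<C> f \<odot> Dom \<C> g"
    "Cod \<C> (f \<star> g) = Cod \<C> f \<odot> Cod \<C> g" "starts X (f \<star> g) \<longleftrightarrow> X = Dom \<C> f \<odot> Dom \<C> g"
    by (auto simp: hom_iff starts_def)
qed

lemma ident [simp]: "A \<in> Obj \<C> \<Longrightarrow> B \<in> Obj \<C> \<Longrightarrow> \<iota> A \<star> \<iota> B = \<iota> (A \<odot> B)"
  using is_bifunctor by (simp add: bifunctor_def)

text \<open>Oriented to fuse layers, and not a default rule: proofs opt in where layers should merge
  and otherwise keep them apart so that naturality can act on one of them.\<close>

lemma comp:
  assumes "f \<in> Arr \<C>" "starts (Cod \<C> f) f'" "g \<in> Arr \<C>" "starts (Cod \<C> g) g'"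
  shows "(f \<star> g) \<Zsemi> (f' \<star> g') = (f \<Zsemi> f') \<star> (g \<Zsemi> g')"
proof -
  have "f \<in> hom \<C> (Dom \<C> f) (Dom \<C> f')" "f' \<in> hom \<C> (Dom \<C> f') (Cod \<C> f')"
    "g \<in> hom \<C> (Dom \<C> g) (Dom \<C> g')" "g' \<in> hom \<C> (Dom \<C> g') (Cod \<C> g')"
    using assms by (auto simp: hom_iff starts_def)
  then show ?thesis
    by (rule is_bifunctor[unfolded bifunctor_def, THEN conjunct2, THEN conjunct2, THEN conjunct2,
        rule_format, symmetric])
qed

lemma comp_tail:
  assumes "f \<in> Arr \<C>" "starts (Cod \<C> f) f'" "g \<in> Arr \<C>" "starts (Cod \<C> g) g'"
    and "starts (Cod \<C> f' \<odot> Cod \<C> g') z"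
  shows "(f \<star> g) \<Zsemi> ((f' \<star> g') \<Zsemi> z) = ((f \<Zsemi> f') \<star> (g \<Zsemi> g')) \<Zsemi> z"
  using assms comp[of f f' g g'] by (auto simp: reassoc starts_def)

lemma iso [simp]:
  assumes "is_iso f" "is_iso g"
  shows "is_iso (f \<star> g)"
  by (rule is_isoI[of _ "inv f \<star> inv g"]) (use assms in \<open>auto simp: is_iso_arr comp starts_def\<close>)

lemma inv [simp]:
  assumes "is_iso f" "is_iso g"
  shows "inv (f \<star> g) = inv f \<star> inv g"
  by (rule inv_eqI) (use assms in \<open>auto simp: is_iso_arr comp starts_def\<close>)

end

section \<open>Compatibility of a braiding with the unit, from one hexagon\<close>

locale hexagon_monoidal = bifunctor_category \<C> P p
  for \<C> :: "('o, 'm, 'x) cat_scheme" (structure)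
    and P :: "'o \<Rightarrow> 'o \<Rightarrow> 'o" (infixl "\<odot>" 70)
    and p :: "'m \<Rightarrow> 'm \<Rightarrow> 'm" (infixl "\<star>" 70) +
  fixes e :: 'o
    and assoc :: "'o \<Rightarrow> 'o \<Rightarrow> 'o \<Rightarrow> 'm"
    and lunit :: "'o \<Rightarrow> 'm"
    and runit :: "'o \<Rightarrow> 'm"
    and swap :: "'o \<Rightarrow> 'o \<Rightarrow> 'm"
  assumes unit_obj [simp]: "e \<in> Obj \<C>"
    and assoc_iso: "\<lbrakk>A \<in> Obj \<C>; B \<in> Obj \<C>; C \<in> Obj \<C>\<rbrakk> \<Longrightarrow>
      assoc A B C \<in> isos \<C> ((A \<odot> B) \<odot> C) (A \<odot> (B \<odot> C))"
    and assoc_nat: "\<lbrakk>f \<in> hom \<C> A A'; g \<in> hom \<C> B B'; h \<in> hom \<C> C C'\<rbrakk> \<Longrightarrow>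
      ((f \<star> g) \<star> h) \<Zsemi> assoc A' B' C' = assoc A B C \<Zsemi> (f \<star> (g \<star> h))"
    and lunit_iso: "A \<in> Obj \<C> \<Longrightarrow> lunit A \<in> isos \<C> (e \<odot> A) A"
    and lunit_nat: "f \<in> hom \<C> A A' \<Longrightarrow> (\<iota> e \<star> f) \<Zsemi> lunit A' = lunit A \<Zsemi> f"
    and runit_iso: "A \<in> Obj \<C> \<Longrightarrow> runit A \<in> isos \<C> (A \<odot> e) A"
    and runit_nat: "f \<in> hom \<C> A A' \<Longrightarrow> (f \<star> \<iota> e) \<Zsemi> runit A' = runit A \<Zsemi> f"
    and swap_iso: "\<lbrakk>A \<in> Obj \<C>; B \<in> Obj \<C>\<rbrakk> \<Longrightarrow> swap A B \<in> isos \<C> (A \<odot> B) (B \<odot> A)"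
    and swap_nat: "\<lbrakk>f \<in> hom \<C> A A'; g \<in> hom \<C> B B'\<rbrakk> \<Longrightarrow>
      (f \<star> g) \<Zsemi> swap A' B' = swap A B \<Zsemi> (g \<star> f)"
    and pentagon: "\<lbrakk>A \<in> Obj \<C>; B \<in> Obj \<C>; C \<in> Obj \<C>; D \<in> Obj \<C>\<rbrakk> \<Longrightarrow>
      assoc (A \<odot> B) C D \<Zsemi> assoc A B (C \<odot> D)
        = (assoc A B C \<star> \<iota> D) \<Zsemi> assoc A (B \<odot> C) D \<Zsemi> (\<iota> A \<star> assoc B C D)"
    and triangle: "\<lbrakk>A \<in> Obj \<C>; B \<in> Obj \<C>\<rbrakk> \<Longrightarrow>
      assoc A e B \<Zsemi> (\<iota> A \<star> lunit B) = runit A \<star> \<iota> B"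
    and hexagon: "\<lbrakk>A \<in> Obj \<C>; B \<in> Obj \<C>; C \<in> Obj \<C>\<rbrakk> \<Longrightarrow>
      assoc A B C \<Zsemi> swap A (B \<odot> C) \<Zsemi> assoc B C A
        = (swap A B \<star> \<iota> C) \<Zsemi> assoc B A C \<Zsemi> (\<iota> B \<star> swap A C)"
begin

lemmas assoc_arr [simp] = isosD[OF assoc_iso]
lemmas lunit_arr [simp] = isosD[OF lunit_iso]
lemmas runit_arr [simp] = isosD[OF runit_iso]
lemmas swap_arr [simp] = isosD[OF swap_iso]

text \<open>Naturality recovers \<open>lunit A \<Zsemi> f\<close> from
  \<open>\<iota> e \<star> f\<close>, and \<open>lunit A\<close> is invertible.\<close>

lemma lunit_faithful:
  assumes "\<iota> e \<star> f = \<iota> e \<star> g" "f \<in> hom \<C> A B" "g \<in> hom \<C> A B"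
  shows "f = g"
proof -
  have "A \<in> Obj \<C>" using assms(2) dom_obj by (auto simp: hom_iff)
  moreover have "lunit A \<Zsemi> f = lunit A \<Zsemi> g"
    using assms lunit_nat[OF assms(2)] lunit_nat[OF assms(3)] by simp
  ultimately show ?thesis
    using assms by (intro iso_cancel_left[of "lunit A" f g]) (auto simp: hom_iff starts_def)
qed

lemma runit_faithful:
  assumes "f \<star> \<iota> e = g \<star> \<iota> e" "f \<in> hom \<C> A B" "g \<in> hom \<C> A B"
  shows "f = g"
proof -
  have "A \<in> Obj \<C>" using assms(2) dom_obj by (auto simp: hom_iff)
  moreover have "runit A \<Zsemi> f = runit A \<Zsemi> g"
    using assms runit_nat[OF assms(2)] runit_nat[OF assms(3)] by simp
  ultimately show ?thesis
    using assms by (intro iso_cancel_left[of "runit A" f g]) (auto simp: hom_iff starts_def)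
qed

text \<open>Kelly's argument: tensored with the unit on the left, both sides are completed by the
  pentagon and the triangle to the same arrow.\<close>

lemma assoc_lunit:
  assumes [simp]: "B \<in> Obj \<C>" "C \<in> Obj \<C>"
  shows "assoc e B C \<Zsemi> lunit (B \<odot> C) = lunit B \<star> \<iota> C"
proof (rule lunit_faithful)
  let ?k = "(assoc e e B \<star> \<iota> C) \<Zsemi> assoc e (e \<odot> B) C"
  have "?k \<Zsemi> (\<iota> e \<star> (assoc e B C \<Zsemi> lunit (B \<odot> C)))
      = ?k \<Zsemi> (\<iota> e \<star> assoc e B C) \<Zsemi> (\<iota> e \<star> lunit (B \<odot> C))"
    by (simp add: comp_assoc comp)
  also have "\<dots> = assoc (e \<odot> e) B C \<Zsemi> assoc e e (B \<odot> C) \<Zsemi> (\<iota> e \<star> lunit (B \<odot> C))"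
    by (simp add: pentagon)
  also have "\<dots> = assoc (e \<odot> e) B C \<Zsemi> (runit e \<star> (\<iota> B \<star> \<iota> C))"
    by (simp add: comp_assoc triangle)
  also have "\<dots> = ((runit e \<star> \<iota> B) \<star> \<iota> C) \<Zsemi> assoc e B C"
    by (rule assoc_nat[symmetric]) (simp_all add: hom_iff)
  also have "\<dots> = (assoc e e B \<star> \<iota> C) \<Zsemi> (((\<iota> e \<star> lunit B) \<star> \<iota> C) \<Zsemi> assoc e B C)"
    by (simp add: comp_tail triangle)
  also have "((\<iota> e \<star> lunit B) \<star> \<iota> C) \<Zsemi> assoc e B C = assoc e (e \<odot> B) C \<Zsemi> (\<iota> e \<star> (lunit B \<star> \<iota> C))"
    by (rule assoc_nat) (simp_all add: hom_iff)
  also have "(assoc e e B \<star> \<iota> C) \<Zsemi> \<dots> = ?k \<Zsemi> (\<iota> e \<star> (lunit B \<star> \<iota> C))"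
    by (simp add: comp_assoc)
  finally show "\<iota> e \<star> (assoc e B C \<Zsemi> lunit (B \<odot> C)) = \<iota> e \<star> (lunit B \<star> \<iota> C)"
    by (rule iso_cancel_left) simp_all
qed (simp_all add: hom_iff)

text \<open>The hexagon for \<open>A\<close>, \<open>e\<close>, \<open>e\<close> is evaluated after
  tensoring with \<open>e\<close> on the right, which \<open>runit_faithful\<close> undoes. One use
  of \<open>assoc_lunit\<close> prepares one side of the hexagon, another consumes the associator on
  its other side, and the triangle finishes.\<close>

lemma swap_unit:
  assumes [simp]: "A \<in> Obj \<C>"
  shows "swap A e \<Zsemi> lunit A = runit A"
proof (rule runit_faithful)
  \<comment> \<open>The extra \<open>swap A e\<close> becomes the second braiding of the hexagon, by
    naturality of \<open>lunit\<close>; a copy of it survives on the other side and is cancelled at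
    the end.\<close>
  have "((swap A e \<Zsemi> lunit A) \<star> \<iota> e) \<Zsemi> swap A e
      = (swap A e \<star> \<iota> e) \<Zsemi> (lunit A \<star> \<iota> e) \<Zsemi> swap A e"
    by (simp add: comp)
  also have "\<dots> = (swap A e \<star> \<iota> e) \<Zsemi> assoc e A e \<Zsemi> (lunit (A \<odot> e) \<Zsemi> swap A e)"
    by (simp add: comp_assoc flip: assoc_lunit)
  also have "lunit (A \<odot> e) \<Zsemi> swap A e = (\<iota> e \<star> swap A e) \<Zsemi> lunit (e \<odot> A)"
    by (rule lunit_nat[symmetric]) (simp add: hom_iff)
  also have "(swap A e \<star> \<iota> e) \<Zsemi> assoc e A e \<Zsemi> \<dots>
      = ((swap A e \<star> \<iota> e) \<Zsemi> assoc e A e \<Zsemi> (\<iota> e \<star> swap A e)) \<Zsemi> lunit (e \<odot> A)"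
    by (simp add: comp_assoc)
  also have "\<dots> = assoc A e e \<Zsemi> (swap A (e \<odot> e) \<Zsemi> (assoc e e A \<Zsemi> lunit (e \<odot> A)))"
    by (subst hexagon[symmetric]) (simp_all add: comp_assoc)
  also have "\<dots> = assoc A e e \<Zsemi> (swap A (e \<odot> e) \<Zsemi> (lunit e \<star> \<iota> A))"
    by (simp add: assoc_lunit)
  also have "swap A (e \<odot> e) \<Zsemi> (lunit e \<star> \<iota> A) = (\<iota> A \<star> lunit e) \<Zsemi> swap A e"
    by (rule swap_nat[symmetric]) (simp_all add: hom_iff)
  also have "assoc A e e \<Zsemi> \<dots> = (runit A \<star> \<iota> e) \<Zsemi> swap A e"
    by (simp add: reassoc[OF triangle])
  finally show "(swap A e \<Zsemi> lunit A) \<star> \<iota> e = runit A \<star> \<iota> e"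
    by (rule iso_cancel_right) simp_all
qed (simp_all add: hom_iff)

end

section \<open>The sum and the tensor as instances\<close>

sublocale bd_structure \<subseteq> sum: bifunctor_category \<C> "(\<oplus>)" "(\<boxplus>)"
  by unfold_locales (rule sum_bifunctor)

sublocale bd_structure \<subseteq> tensor: bifunctor_category \<C> "(\<otimes>)" "(\<boxtimes>)"
  by unfold_locales (rule tensor_bifunctor)

sublocale bd_category \<subseteq> sum: hexagon_monoidal \<C> "(\<oplus>)" "(\<boxplus>)" \<zero> "\<alpha>\<^sup>\<oplus>" "\<lambda>\<^sup>\<oplus>" "\<rho>\<^sup>\<oplus>" "\<gamma>\<^sup>\<oplus>"
  by unfold_locales
    (rule zero_obj sum_assoc_iso sum_assoc_nat sum_left_unit_iso sum_left_unit_nat sum_right_unit_iso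
      sum_right_unit_nat sum_swap_iso sum_swap_nat sum_pentagon sum_triangle sum_hexagon; assumption)+

sublocale bd_category \<subseteq> tensor: hexagon_monoidal \<C> "(\<otimes>)" "(\<boxtimes>)" \<one> "\<alpha>\<^sup>\<otimes>" "\<lambda>\<^sup>\<otimes>" "\<rho>\<^sup>\<otimes>" "\<gamma>\<^sup>\<otimes>"
  by unfold_locales
    (rule one_obj tensor_assoc_iso tensor_assoc_nat tensor_left_unit_iso tensor_left_unit_nat
      tensor_right_unit_iso tensor_right_unit_nat tensor_swap_iso tensor_swap_nat tensor_pentagon
      tensor_triangle tensor_hexagon; assumption)+

section \<open>The right distributor: naturality and additive conditions\<close>

context bd_category
begin

lemmas distrib_arr [simp] = isosD[OF distrib_iso]
lemmas annih_arr [simp] = isosD[OF annih_iso]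

lemma right_distrib_arr [simp]:
  assumes "A \<in> Obj \<C>" "B \<in> Obj \<C>" "C \<in> Obj \<C>"
  shows "\<delta>\<^sup># A B C \<in> Arr \<C>" "Dom \<C> (\<delta>\<^sup># A B C) = (A \<oplus> B) \<otimes> C"
    "Cod \<C> (\<delta>\<^sup># A B C) = A \<otimes> C \<oplus> B \<otimes> C" "starts X (\<delta>\<^sup># A B C) \<longleftrightarrow> X = (A \<oplus> B) \<otimes> C"
  using assms by (simp_all add: right_distrib_def)

text \<open>The definition with its inverse cleared; most later arguments use
  \<open>\<delta>\<^sup>#\<close> only in this form.\<close>

lemma right_distrib_swap:
  assumes [simp]: "A \<in> Obj \<C>" "B \<in> Obj \<C>" "C \<in> Obj \<C>"
  shows "\<delta>\<^sup># A B C \<Zsemi> (\<gamma>\<^sup>\<otimes> A C \<boxplus> \<gamma>\<^sup>\<otimes> B C) = \<gamma>\<^sup>\<otimes> (A \<oplus> B) C \<Zsemi> \<delta> C A B"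
  by (simp add: right_distrib_def comp_assoc sum.comp)

text \<open>Needed in \<open>right_distrib_tensor_assoc\<close> to slide braidings through the outer
  right distributor. It is naturality of \<delta> and of the braiding, transported by
  \<open>right_distrib_swap\<close>.\<close>

lemma right_distrib_nat:
  assumes "f \<in> hom \<C> A A'" "g \<in> hom \<C> B B'" "h \<in> hom \<C> C C'"
  shows "((f \<boxplus> g) \<boxtimes> h) \<Zsemi> \<delta>\<^sup># A' B' C' = \<delta>\<^sup># A B C \<Zsemi> (f \<boxtimes> h \<boxplus> g \<boxtimes> h)"
proof (rule iso_cancel_right)
  have [simp]: "A \<in> Obj \<C>" "B \<in> Obj \<C>" "C \<in> Obj \<C>" "A' \<in> Obj \<C>" "B' \<in> Obj \<C>" "C' \<in> Obj \<C>"
    and f [simp]: "f \<in> Arr \<C>" "Dom \<C> f = A" "Cod \<C> f = A'"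
    and g [simp]: "g \<in> Arr \<C>" "Dom \<C> g = B" "Cod \<C> g = B'"
    and h [simp]: "h \<in> Arr \<C>" "Dom \<C> h = C" "Cod \<C> h = C'"
    using assms dom_obj cod_obj by (auto simp: hom_iff)
  have fg: "f \<boxplus> g \<in> hom \<C> (A \<oplus> B) (A' \<oplus> B')" by (simp add: hom_iff)
  show "is_iso (\<gamma>\<^sup>\<otimes> A' C' \<boxplus> \<gamma>\<^sup>\<otimes> B' C')" by simp
  have "((f \<boxplus> g) \<boxtimes> h) \<Zsemi> \<delta>\<^sup># A' B' C' \<Zsemi> (\<gamma>\<^sup>\<otimes> A' C' \<boxplus> \<gamma>\<^sup>\<otimes> B' C')
      = ((f \<boxplus> g) \<boxtimes> h) \<Zsemi> \<gamma>\<^sup>\<otimes> (A' \<oplus> B') C' \<Zsemi> \<delta> C' A' B'"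
    by (simp add: comp_assoc right_distrib_swap)
  also have "\<dots> = \<gamma>\<^sup>\<otimes> (A \<oplus> B) C \<Zsemi> \<delta> C A B \<Zsemi> (h \<boxtimes> f \<boxplus> h \<boxtimes> g)"
    by (simp add: comp_assoc distrib_nat[OF assms(3,1,2)] tensor_swap_nat[OF fg assms(3)])
  also have "\<dots> = \<delta>\<^sup># A B C \<Zsemi> (f \<boxtimes> h \<boxplus> g \<boxtimes> h) \<Zsemi> (\<gamma>\<^sup>\<otimes> A' C' \<boxplus> \<gamma>\<^sup>\<otimes> B' C')"
    by (simp add: comp_assoc sum.comp tensor_swap_nat[OF assms(1,3)] tensor_swap_nat[OF assms(2,3)]
        flip: right_distrib_swap)
  finally show "((f \<boxplus> g) \<boxtimes> h) \<Zsemi> \<delta>\<^sup># A' B' C' \<Zsemi> (\<gamma>\<^sup>\<otimes> A' C' \<boxplus> \<gamma>\<^sup>\<otimes> B' C')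
    = \<delta>\<^sup># A B C \<Zsemi> (f \<boxtimes> h \<boxplus> g \<boxtimes> h) \<Zsemi> (\<gamma>\<^sup>\<otimes> A' C' \<boxplus> \<gamma>\<^sup>\<otimes> B' C')" .
qed (use assms dom_obj cod_obj in \<open>auto simp: hom_iff starts_def\<close>)

lemma right_distrib_sum_swap:
  assumes [simp]: "A \<in> Obj \<C>" "B \<in> Obj \<C>" "C \<in> Obj \<C>"
  shows "\<delta>\<^sup># A B C \<Zsemi> \<gamma>\<^sup>\<oplus> (A \<otimes> C) (B \<otimes> C) = (\<gamma>\<^sup>\<oplus> A B \<boxtimes> \<iota> C) \<Zsemi> \<delta>\<^sup># B A C"
proof (rule iso_cancel_right)
  show "is_iso (\<gamma>\<^sup>\<otimes> B C \<boxplus> \<gamma>\<^sup>\<otimes> A C)" by simp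
  have "\<delta>\<^sup># A B C \<Zsemi> \<gamma>\<^sup>\<oplus> (A \<otimes> C) (B \<otimes> C) \<Zsemi> (\<gamma>\<^sup>\<otimes> B C \<boxplus> \<gamma>\<^sup>\<otimes> A C)
      = \<delta>\<^sup># A B C \<Zsemi> ((\<gamma>\<^sup>\<otimes> A C \<boxplus> \<gamma>\<^sup>\<otimes> B C) \<Zsemi> \<gamma>\<^sup>\<oplus> (C \<otimes> A) (C \<otimes> B))"
    by (simp add: comp_assoc sum_swap_nat[of _ "A \<otimes> C" _ _ "B \<otimes> C"] hom_iff)
  also have "\<dots> = \<gamma>\<^sup>\<otimes> (A \<oplus> B) C \<Zsemi> (\<delta> C A B \<Zsemi> \<gamma>\<^sup>\<oplus> (C \<otimes> A) (C \<otimes> B))"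
    by (simp add: comp_assoc reassoc[OF right_distrib_swap])
  \<comment> \<open>Rewriting \<delta> by its swapped form produces an additive swap in the opposite
    direction, which \<open>sum_symmetry\<close> cancels.\<close>
  also have "\<delta> C A B \<Zsemi> \<gamma>\<^sup>\<oplus> (C \<otimes> A) (C \<otimes> B) = (\<iota> C \<boxtimes> \<gamma>\<^sup>\<oplus> A B) \<Zsemi> \<delta> C B A"
    by (subst distrib_sum_swap) (simp_all add: comp_assoc sum_symmetry)
  also have "\<gamma>\<^sup>\<otimes> (A \<oplus> B) C \<Zsemi> \<dots> = (\<gamma>\<^sup>\<otimes> (A \<oplus> B) C \<Zsemi> (\<iota> C \<boxtimes> \<gamma>\<^sup>\<oplus> A B)) \<Zsemi> \<delta> C B A"
    by (simp add: comp_assoc)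
  also have "\<gamma>\<^sup>\<otimes> (A \<oplus> B) C \<Zsemi> (\<iota> C \<boxtimes> \<gamma>\<^sup>\<oplus> A B) = (\<gamma>\<^sup>\<oplus> A B \<boxtimes> \<iota> C) \<Zsemi> \<gamma>\<^sup>\<otimes> (B \<oplus> A) C"
    by (rule tensor_swap_nat[symmetric]) (simp_all add: hom_iff)
  also have "\<dots> \<Zsemi> \<delta> C B A = (\<gamma>\<^sup>\<oplus> A B \<boxtimes> \<iota> C) \<Zsemi> \<delta>\<^sup># B A C \<Zsemi> (\<gamma>\<^sup>\<otimes> B C \<boxplus> \<gamma>\<^sup>\<otimes> A C)"
    by (simp add: comp_assoc right_distrib_swap)
  finally show "\<delta>\<^sup># A B C \<Zsemi> \<gamma>\<^sup>\<oplus> (A \<otimes> C) (B \<otimes> C) \<Zsemi> (\<gamma>\<^sup>\<otimes> B C \<boxplus> \<gamma>\<^sup>\<otimes> A C)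
    = (\<gamma>\<^sup>\<oplus> A B \<boxtimes> \<iota> C) \<Zsemi> \<delta>\<^sup># B A C \<Zsemi> (\<gamma>\<^sup>\<otimes> B C \<boxplus> \<gamma>\<^sup>\<otimes> A C)" .
qed simp_all

text \<open>\<open>?g\<close> braids \<open>D\<close> to the front in all three summands and so
  reduces the claim to \<open>distrib_sum_assoc\<close> with \<open>D\<close> as the distributing
  factor. It is bracketed like the common codomain; naturality of the sum associator supplies the
  other bracketing.\<close>

lemma right_distrib_sum_assoc:
  assumes [simp]: "A \<in> Obj \<C>" "B \<in> Obj \<C>" "C \<in> Obj \<C>" "D \<in> Obj \<C>"
  shows "(\<alpha>\<^sup>\<oplus> A B C \<boxtimes> \<iota> D) \<Zsemi> \<delta>\<^sup># A (B \<oplus> C) D \<Zsemi> (\<iota> (A \<otimes> D) \<boxplus> \<delta>\<^sup># B C D)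
    = \<delta>\<^sup># (A \<oplus> B) C D \<Zsemi> (\<delta>\<^sup># A B D \<boxplus> \<iota> (C \<otimes> D)) \<Zsemi> \<alpha>\<^sup>\<oplus> (A \<otimes> D) (B \<otimes> D) (C \<otimes> D)"
    (is "?L = ?R")
proof (rule iso_cancel_right)
  let ?g = "\<gamma>\<^sup>\<otimes> A D \<boxplus> (\<gamma>\<^sup>\<otimes> B D \<boxplus> \<gamma>\<^sup>\<otimes> C D)"
  show "is_iso ?g" by simp
  have "?L \<Zsemi> ?g = (\<alpha>\<^sup>\<oplus> A B C \<boxtimes> \<iota> D) \<Zsemi> (\<delta>\<^sup># A (B \<oplus> C) D \<Zsemi> (\<gamma>\<^sup>\<otimes> A D \<boxplus> \<gamma>\<^sup>\<otimes> (B \<oplus> C) D))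
      \<Zsemi> (\<iota> (D \<otimes> A) \<boxplus> \<delta> D B C)"
    by (simp add: comp_assoc sum.comp right_distrib_swap[of B C D])
  also have "\<dots> = ((\<alpha>\<^sup>\<oplus> A B C \<boxtimes> \<iota> D) \<Zsemi> \<gamma>\<^sup>\<otimes> (A \<oplus> (B \<oplus> C)) D) \<Zsemi> \<delta> D A (B \<oplus> C)
      \<Zsemi> (\<iota> (D \<otimes> A) \<boxplus> \<delta> D B C)"
    by (subst right_distrib_swap) (simp_all add: comp_assoc)
  also have "(\<alpha>\<^sup>\<oplus> A B C \<boxtimes> \<iota> D) \<Zsemi> \<gamma>\<^sup>\<otimes> (A \<oplus> (B \<oplus> C)) D = \<gamma>\<^sup>\<otimes> (A \<oplus> B \<oplus> C) D \<Zsemi> (\<iota> D \<boxtimes> \<alpha>\<^sup>\<oplus> A B C)"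
    by (rule tensor_swap_nat) (simp_all add: hom_iff)
  also have "\<dots> \<Zsemi> \<delta> D A (B \<oplus> C) \<Zsemi> (\<iota> (D \<otimes> A) \<boxplus> \<delta> D B C)
      = \<gamma>\<^sup>\<otimes> (A \<oplus> B \<oplus> C) D \<Zsemi> ((\<iota> D \<boxtimes> \<alpha>\<^sup>\<oplus> A B C) \<Zsemi> \<delta> D A (B \<oplus> C) \<Zsemi> (\<iota> (D \<otimes> A) \<boxplus> \<delta> D B C))"
    by (simp add: comp_assoc)
  also have "\<dots> = (\<gamma>\<^sup>\<otimes> (A \<oplus> B \<oplus> C) D \<Zsemi> \<delta> D (A \<oplus> B) C)
      \<Zsemi> (\<delta> D A B \<boxplus> \<iota> (D \<otimes> C)) \<Zsemi> \<alpha>\<^sup>\<oplus> (D \<otimes> A) (D \<otimes> B) (D \<otimes> C)"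
    unfolding distrib_sum_assoc[OF assms(4,1,2,3)] by (simp add: comp_assoc)
  \<comment> \<open>Read backwards, \<open>right_distrib_swap\<close> leaves a braiding of
    \<open>A \<oplus> B\<close> past \<open>D\<close> in the left summand, which is what the inner
    right distributor needs in turn.\<close>
  also have "\<dots> = \<delta>\<^sup># (A \<oplus> B) C D \<Zsemi> ((\<gamma>\<^sup>\<otimes> (A \<oplus> B) D \<Zsemi> \<delta> D A B) \<boxplus> \<gamma>\<^sup>\<otimes> C D)
      \<Zsemi> \<alpha>\<^sup>\<oplus> (D \<otimes> A) (D \<otimes> B) (D \<otimes> C)"
    by (simp add: comp_assoc sum.comp_tail flip: right_distrib_swap[of "A \<oplus> B"])
  also have "\<dots> = \<delta>\<^sup># (A \<oplus> B) C D \<Zsemi> (\<delta>\<^sup># A B D \<boxplus> \<iota> (C \<otimes> D))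
      \<Zsemi> (((\<gamma>\<^sup>\<otimes> A D \<boxplus> \<gamma>\<^sup>\<otimes> B D) \<boxplus> \<gamma>\<^sup>\<otimes> C D) \<Zsemi> \<alpha>\<^sup>\<oplus> (D \<otimes> A) (D \<otimes> B) (D \<otimes> C))"
    by (simp add: comp_assoc sum.comp_tail right_distrib_swap)
  also have "((\<gamma>\<^sup>\<otimes> A D \<boxplus> \<gamma>\<^sup>\<otimes> B D) \<boxplus> \<gamma>\<^sup>\<otimes> C D) \<Zsemi> \<alpha>\<^sup>\<oplus> (D \<otimes> A) (D \<otimes> B) (D \<otimes> C)
      = \<alpha>\<^sup>\<oplus> (A \<otimes> D) (B \<otimes> D) (C \<otimes> D) \<Zsemi> ?g"
    by (rule sum_assoc_nat) (simp_all add: hom_iff)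
  finally show "?L \<Zsemi> ?g = ?R \<Zsemi> ?g"
    by (simp add: comp_assoc)
qed simp_all

section \<open>Right distributor and tensor associator\<close>

text \<open>The second hexagon solved for the braiding. The axiom speaks of inverse braidings; at
  \<open>C\<close>, \<open>A\<close>, \<open>B\<close> its right side is \<open>?h\<close>, with
  inverse \<open>?k\<close>, and solving leaves only forward braidings: \<open>C\<close> passes
  \<open>B\<close>, then \<open>A\<close>.\<close>

lemma tensor_swap_tensor_left:
  assumes [simp]: "A \<in> Obj \<C>" "B \<in> Obj \<C>" "C \<in> Obj \<C>"
  shows "\<gamma>\<^sup>\<otimes> (A \<otimes> B) C = \<alpha>\<^sup>\<otimes> A B C \<Zsemi> (\<iota> A \<boxtimes> \<gamma>\<^sup>\<otimes> B C) \<Zsemi> inv (\<alpha>\<^sup>\<otimes> A C B)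
    \<Zsemi> (\<gamma>\<^sup>\<otimes> A C \<boxtimes> \<iota> B) \<Zsemi> \<alpha>\<^sup>\<otimes> C A B"
proof -
  let ?h = "(inv (\<gamma>\<^sup>\<otimes> A C) \<boxtimes> \<iota> B) \<Zsemi> \<alpha>\<^sup>\<otimes> A C B \<Zsemi> (\<iota> A \<boxtimes> inv (\<gamma>\<^sup>\<otimes> B C))"
  let ?k = "(\<iota> A \<boxtimes> \<gamma>\<^sup>\<otimes> B C) \<Zsemi> inv (\<alpha>\<^sup>\<otimes> A C B) \<Zsemi> (\<gamma>\<^sup>\<otimes> A C \<boxtimes> \<iota> B)"
  have hk: "?h \<Zsemi> ?k = \<iota> ((C \<otimes> A) \<otimes> B)"
    by (simp add: comp_assoc tensor.comp tensor.comp_tail)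
  have "\<alpha>\<^sup>\<otimes> C A B = (\<alpha>\<^sup>\<otimes> C A B \<Zsemi> inv (\<gamma>\<^sup>\<otimes> (A \<otimes> B) C) \<Zsemi> \<alpha>\<^sup>\<otimes> A B C)
      \<Zsemi> (inv (\<alpha>\<^sup>\<otimes> A B C) \<Zsemi> \<gamma>\<^sup>\<otimes> (A \<otimes> B) C)"
    by (simp add: comp_assoc)
  also have "\<dots> = ?h \<Zsemi> (inv (\<alpha>\<^sup>\<otimes> A B C) \<Zsemi> \<gamma>\<^sup>\<otimes> (A \<otimes> B) C)"
    by (simp only: tensor_hexagon_inv[OF assms(3,1,2)])
  finally have a: "\<alpha>\<^sup>\<otimes> C A B = ?h \<Zsemi> (inv (\<alpha>\<^sup>\<otimes> A B C) \<Zsemi> \<gamma>\<^sup>\<otimes> (A \<otimes> B) C)" .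
  have "\<alpha>\<^sup>\<otimes> A B C \<Zsemi> ?k \<Zsemi> \<alpha>\<^sup>\<otimes> C A B = \<gamma>\<^sup>\<otimes> (A \<otimes> B) C"
    unfolding a by (simp add: comp_assoc tensor.comp_tail)
  then show ?thesis by (simp add: comp_assoc)
qed

text \<open>\<open>?q X\<close> is what remains of the braiding of \<open>A \<otimes> X\<close> past
  \<open>D\<close> once \<open>\<alpha>\<^sup>\<otimes> A X D\<close> is split off. Completed by
  \<open>?g\<close>, the left side carries \<open>D\<close> across each product at once, the right
  side carries it across the sum and then across \<open>A\<close>. Both reduce to the composite in
  \<open>L\<close>, where the whole product is braided past \<open>D\<close> before any
  distribution.\<close>

lemma right_distrib_tensor_middle:
  assumes [simp]: "A \<in> Obj \<C>" "B \<in> Obj \<C>" "C \<in> Obj \<C>" "D \<in> Obj \<C>"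
  shows "(\<delta> A B C \<boxtimes> \<iota> D) \<Zsemi> \<delta>\<^sup># (A \<otimes> B) (A \<otimes> C) D \<Zsemi> (\<alpha>\<^sup>\<otimes> A B D \<boxplus> \<alpha>\<^sup>\<otimes> A C D)
    = \<alpha>\<^sup>\<otimes> A (B \<oplus> C) D \<Zsemi> (\<iota> A \<boxtimes> \<delta>\<^sup># B C D) \<Zsemi> \<delta> A (B \<otimes> D) (C \<otimes> D)"
    (is "?L = ?R")
proof (rule iso_cancel_right)
  let ?q = "\<lambda>X. (\<iota> A \<boxtimes> \<gamma>\<^sup>\<otimes> X D) \<Zsemi> (inv (\<alpha>\<^sup>\<otimes> A D X) \<Zsemi> ((\<gamma>\<^sup>\<otimes> A D \<boxtimes> \<iota> X) \<Zsemi> \<alpha>\<^sup>\<otimes> D A X))"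
  let ?g = "?q B \<boxplus> ?q C"
  have q: "\<alpha>\<^sup>\<otimes> A X D \<Zsemi> ?q X = \<gamma>\<^sup>\<otimes> (A \<otimes> X) D" if [simp]: "X \<in> Obj \<C>" for X
    by (simp add: tensor_swap_tensor_left[of A X D] comp_assoc)
  show "is_iso ?g" by simp
  have "?L \<Zsemi> ?g = (\<delta> A B C \<boxtimes> \<iota> D) \<Zsemi> (\<delta>\<^sup># (A \<otimes> B) (A \<otimes> C) D \<Zsemi> (\<gamma>\<^sup>\<otimes> (A \<otimes> B) D \<boxplus> \<gamma>\<^sup>\<otimes> (A \<otimes> C) D))"
    by (simp add: comp_assoc sum.comp q)
  also have "\<dots> = ((\<delta> A B C \<boxtimes> \<iota> D) \<Zsemi> \<gamma>\<^sup>\<otimes> (A \<otimes> B \<oplus> A \<otimes> C) D) \<Zsemi> \<delta> D (A \<otimes> B) (A \<otimes> C)"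
    by (simp add: comp_assoc right_distrib_swap)
  also have "(\<delta> A B C \<boxtimes> \<iota> D) \<Zsemi> \<gamma>\<^sup>\<otimes> (A \<otimes> B \<oplus> A \<otimes> C) D = \<gamma>\<^sup>\<otimes> (A \<otimes> (B \<oplus> C)) D \<Zsemi> (\<iota> D \<boxtimes> \<delta> A B C)"
    by (rule tensor_swap_nat) (simp_all add: hom_iff)
  finally have L: "?L \<Zsemi> ?g
      = \<gamma>\<^sup>\<otimes> (A \<otimes> (B \<oplus> C)) D \<Zsemi> (\<iota> D \<boxtimes> \<delta> A B C) \<Zsemi> \<delta> D (A \<otimes> B) (A \<otimes> C)" .

  have "?R \<Zsemi> ?g = \<alpha>\<^sup>\<otimes> A (B \<oplus> C) D \<Zsemi> (\<iota> A \<boxtimes> \<delta>\<^sup># B C D)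
      \<Zsemi> (\<delta> A (B \<otimes> D) (C \<otimes> D) \<Zsemi> (\<iota> A \<boxtimes> \<gamma>\<^sup>\<otimes> B D \<boxplus> \<iota> A \<boxtimes> \<gamma>\<^sup>\<otimes> C D))
      \<Zsemi> (inv (\<alpha>\<^sup>\<otimes> A D B) \<boxplus> inv (\<alpha>\<^sup>\<otimes> A D C))
      \<Zsemi> (\<gamma>\<^sup>\<otimes> A D \<boxtimes> \<iota> B \<boxplus> \<gamma>\<^sup>\<otimes> A D \<boxtimes> \<iota> C) \<Zsemi> (\<alpha>\<^sup>\<otimes> D A B \<boxplus> \<alpha>\<^sup>\<otimes> D A C)"
    by (simp add: comp_assoc sum.comp sum.comp_tail)
  also have "\<delta> A (B \<otimes> D) (C \<otimes> D) \<Zsemi> (\<iota> A \<boxtimes> \<gamma>\<^sup>\<otimes> B D \<boxplus> \<iota> A \<boxtimes> \<gamma>\<^sup>\<otimes> C D)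
      = (\<iota> A \<boxtimes> (\<gamma>\<^sup>\<otimes> B D \<boxplus> \<gamma>\<^sup>\<otimes> C D)) \<Zsemi> \<delta> A (D \<otimes> B) (D \<otimes> C)"
    by (rule distrib_nat[symmetric]) (simp_all add: hom_iff)
  also have "\<alpha>\<^sup>\<otimes> A (B \<oplus> C) D \<Zsemi> (\<iota> A \<boxtimes> \<delta>\<^sup># B C D) \<Zsemi> \<dots>
      \<Zsemi> (inv (\<alpha>\<^sup>\<otimes> A D B) \<boxplus> inv (\<alpha>\<^sup>\<otimes> A D C))
      \<Zsemi> (\<gamma>\<^sup>\<otimes> A D \<boxtimes> \<iota> B \<boxplus> \<gamma>\<^sup>\<otimes> A D \<boxtimes> \<iota> C) \<Zsemi> (\<alpha>\<^sup>\<otimes> D A B \<boxplus> \<alpha>\<^sup>\<otimes> D A C)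
    = \<alpha>\<^sup>\<otimes> A (B \<oplus> C) D \<Zsemi> (\<iota> A \<boxtimes> \<gamma>\<^sup>\<otimes> (B \<oplus> C) D)
      \<Zsemi> ((\<iota> A \<boxtimes> \<delta> D B C) \<Zsemi> \<delta> A (D \<otimes> B) (D \<otimes> C) \<Zsemi> inv (\<alpha>\<^sup>\<otimes> A D B \<boxplus> \<alpha>\<^sup>\<otimes> A D C))
      \<Zsemi> (\<gamma>\<^sup>\<otimes> A D \<boxtimes> \<iota> B \<boxplus> \<gamma>\<^sup>\<otimes> A D \<boxtimes> \<iota> C) \<Zsemi> (\<alpha>\<^sup>\<otimes> D A B \<boxplus> \<alpha>\<^sup>\<otimes> D A C)"
    by (simp add: comp_assoc tensor.comp_tail right_distrib_swap)
  \<comment> \<open>\<open>distrib_tensor_assoc\<close> for \<open>A\<close>, \<open>D\<close>,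
    solved so that the double distribution becomes a single one over \<open>A \<otimes> D\<close>;
    naturality of \<delta> can then move the braiding of \<open>A\<close> with \<open>D\<close>
    across it.\<close>
  also have "(\<iota> A \<boxtimes> \<delta> D B C) \<Zsemi> \<delta> A (D \<otimes> B) (D \<otimes> C) \<Zsemi> inv (\<alpha>\<^sup>\<otimes> A D B \<boxplus> \<alpha>\<^sup>\<otimes> A D C)
      = inv (\<alpha>\<^sup>\<otimes> A D (B \<oplus> C)) \<Zsemi> \<delta> (A \<otimes> D) B C"
  proof (rule iso_cancel_right[of _ "\<alpha>\<^sup>\<otimes> A D B \<boxplus> \<alpha>\<^sup>\<otimes> A D C"])
    have "inv (\<alpha>\<^sup>\<otimes> A D (B \<oplus> C)) \<Zsemi> (\<delta> (A \<otimes> D) B C \<Zsemi> (\<alpha>\<^sup>\<otimes> A D B \<boxplus> \<alpha>\<^sup>\<otimes> A D C))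
        = (\<iota> A \<boxtimes> \<delta> D B C) \<Zsemi> \<delta> A (D \<otimes> B) (D \<otimes> C)"
      by (subst distrib_tensor_assoc[symmetric]) (simp_all add: comp_assoc)
    then show "(\<iota> A \<boxtimes> \<delta> D B C) \<Zsemi> \<delta> A (D \<otimes> B) (D \<otimes> C) \<Zsemi> inv (\<alpha>\<^sup>\<otimes> A D B \<boxplus> \<alpha>\<^sup>\<otimes> A D C)
        \<Zsemi> (\<alpha>\<^sup>\<otimes> A D B \<boxplus> \<alpha>\<^sup>\<otimes> A D C)
      = inv (\<alpha>\<^sup>\<otimes> A D (B \<oplus> C)) \<Zsemi> \<delta> (A \<otimes> D) B C \<Zsemi> (\<alpha>\<^sup>\<otimes> A D B \<boxplus> \<alpha>\<^sup>\<otimes> A D C)"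
      by (simp add: comp_assoc sum.comp)
  qed simp_all
  also have "\<alpha>\<^sup>\<otimes> A (B \<oplus> C) D \<Zsemi> (\<iota> A \<boxtimes> \<gamma>\<^sup>\<otimes> (B \<oplus> C) D) \<Zsemi> \<dots>
      \<Zsemi> (\<gamma>\<^sup>\<otimes> A D \<boxtimes> \<iota> B \<boxplus> \<gamma>\<^sup>\<otimes> A D \<boxtimes> \<iota> C) \<Zsemi> (\<alpha>\<^sup>\<otimes> D A B \<boxplus> \<alpha>\<^sup>\<otimes> D A C)
    = \<alpha>\<^sup>\<otimes> A (B \<oplus> C) D \<Zsemi> (\<iota> A \<boxtimes> \<gamma>\<^sup>\<otimes> (B \<oplus> C) D) \<Zsemi> inv (\<alpha>\<^sup>\<otimes> A D (B \<oplus> C))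
      \<Zsemi> (\<delta> (A \<otimes> D) B C \<Zsemi> (\<gamma>\<^sup>\<otimes> A D \<boxtimes> \<iota> B \<boxplus> \<gamma>\<^sup>\<otimes> A D \<boxtimes> \<iota> C)) \<Zsemi> (\<alpha>\<^sup>\<otimes> D A B \<boxplus> \<alpha>\<^sup>\<otimes> D A C)"
    by (simp add: comp_assoc)
  also have "\<delta> (A \<otimes> D) B C \<Zsemi> (\<gamma>\<^sup>\<otimes> A D \<boxtimes> \<iota> B \<boxplus> \<gamma>\<^sup>\<otimes> A D \<boxtimes> \<iota> C)
      = (\<gamma>\<^sup>\<otimes> A D \<boxtimes> (\<iota> B \<boxplus> \<iota> C)) \<Zsemi> \<delta> (D \<otimes> A) B C"
    by (rule distrib_nat[symmetric]) (simp_all add: hom_iff)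
  also have "\<alpha>\<^sup>\<otimes> A (B \<oplus> C) D \<Zsemi> (\<iota> A \<boxtimes> \<gamma>\<^sup>\<otimes> (B \<oplus> C) D) \<Zsemi> inv (\<alpha>\<^sup>\<otimes> A D (B \<oplus> C))
      \<Zsemi> \<dots> \<Zsemi> (\<alpha>\<^sup>\<otimes> D A B \<boxplus> \<alpha>\<^sup>\<otimes> D A C)
    = \<alpha>\<^sup>\<otimes> A (B \<oplus> C) D \<Zsemi> (\<iota> A \<boxtimes> \<gamma>\<^sup>\<otimes> (B \<oplus> C) D) \<Zsemi> inv (\<alpha>\<^sup>\<otimes> A D (B \<oplus> C))
      \<Zsemi> (\<gamma>\<^sup>\<otimes> A D \<boxtimes> \<iota> (B \<oplus> C)) \<Zsemi> (\<delta> (D \<otimes> A) B C \<Zsemi> (\<alpha>\<^sup>\<otimes> D A B \<boxplus> \<alpha>\<^sup>\<otimes> D A C))"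
    by (simp add: comp_assoc)
  \<comment> \<open>\<open>distrib_tensor_assoc\<close> backwards, now for \<open>D\<close>,
    \<open>A\<close>, since the braiding has exchanged these factors. The associator it releases
    completes the second hexagon at \<open>B \<oplus> C\<close>.\<close>
  also have "\<dots> = \<gamma>\<^sup>\<otimes> (A \<otimes> (B \<oplus> C)) D \<Zsemi> (\<iota> D \<boxtimes> \<delta> A B C) \<Zsemi> \<delta> D (A \<otimes> B) (A \<otimes> C)"
    by (subst distrib_tensor_assoc[symmetric])
      (simp_all add: tensor_swap_tensor_left[of A "B \<oplus> C" D] comp_assoc)
  finally show "?L \<Zsemi> ?g = ?R \<Zsemi> ?g" by (simp only: L)
qed simp_all

text \<open>By the hexagon \<open>hex\<close>, braiding past \<open>C \<otimes> D\<close> amounts to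
  passing \<open>C\<close> and then \<open>D\<close>. Completing with \<open>?g\<close> thus allows
  \<open>C\<close> to come to the front alone, where \<open>right_distrib_tensor_middle\<close>
  applies with \<open>C\<close> as the outer factor.\<close>

lemma right_distrib_tensor_assoc:
  assumes [simp]: "A \<in> Obj \<C>" "B \<in> Obj \<C>" "C \<in> Obj \<C>" "D \<in> Obj \<C>"
  shows "(\<delta>\<^sup># A B C \<boxtimes> \<iota> D) \<Zsemi> \<delta>\<^sup># (A \<otimes> C) (B \<otimes> C) D \<Zsemi> (\<alpha>\<^sup>\<otimes> A C D \<boxplus> \<alpha>\<^sup>\<otimes> B C D)
    = \<alpha>\<^sup>\<otimes> (A \<oplus> B) C D \<Zsemi> \<delta>\<^sup># A B (C \<otimes> D)"
    (is "?L = ?R")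
proof (rule iso_cancel_right)
  let ?q = "\<lambda>X. \<gamma>\<^sup>\<otimes> X (C \<otimes> D) \<Zsemi> \<alpha>\<^sup>\<otimes> C D X"
  let ?h = "\<lambda>X. (\<gamma>\<^sup>\<otimes> X C \<boxtimes> \<iota> D) \<Zsemi> (\<alpha>\<^sup>\<otimes> C X D \<Zsemi> (\<iota> C \<boxtimes> \<gamma>\<^sup>\<otimes> X D))"
  let ?g = "?q A \<boxplus> ?q B"
  have hex: "\<alpha>\<^sup>\<otimes> X C D \<Zsemi> ?q X = ?h X" if [simp]: "X \<in> Obj \<C>" for X
    using tensor_hexagon[of X C D] by (simp add: comp_assoc)
  show "is_iso ?g" by simp
  have "?L \<Zsemi> ?g = (\<delta>\<^sup># A B C \<boxtimes> \<iota> D)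
      \<Zsemi> (\<delta>\<^sup># (A \<otimes> C) (B \<otimes> C) D \<Zsemi> (\<gamma>\<^sup>\<otimes> A C \<boxtimes> \<iota> D \<boxplus> \<gamma>\<^sup>\<otimes> B C \<boxtimes> \<iota> D))
      \<Zsemi> (\<alpha>\<^sup>\<otimes> C A D \<boxplus> \<alpha>\<^sup>\<otimes> C B D) \<Zsemi> (\<iota> C \<boxtimes> \<gamma>\<^sup>\<otimes> A D \<boxplus> \<iota> C \<boxtimes> \<gamma>\<^sup>\<otimes> B D)"
    by (simp add: comp_assoc sum.comp hex)
  also have "\<delta>\<^sup># (A \<otimes> C) (B \<otimes> C) D \<Zsemi> (\<gamma>\<^sup>\<otimes> A C \<boxtimes> \<iota> D \<boxplus> \<gamma>\<^sup>\<otimes> B C \<boxtimes> \<iota> D)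
      = ((\<gamma>\<^sup>\<otimes> A C \<boxplus> \<gamma>\<^sup>\<otimes> B C) \<boxtimes> \<iota> D) \<Zsemi> \<delta>\<^sup># (C \<otimes> A) (C \<otimes> B) D"
    by (rule right_distrib_nat[symmetric]) (simp_all add: hom_iff)
  also have "(\<delta>\<^sup># A B C \<boxtimes> \<iota> D) \<Zsemi> \<dots>
      \<Zsemi> (\<alpha>\<^sup>\<otimes> C A D \<boxplus> \<alpha>\<^sup>\<otimes> C B D) \<Zsemi> (\<iota> C \<boxtimes> \<gamma>\<^sup>\<otimes> A D \<boxplus> \<iota> C \<boxtimes> \<gamma>\<^sup>\<otimes> B D)
    = (\<gamma>\<^sup>\<otimes> (A \<oplus> B) C \<boxtimes> \<iota> D)
      \<Zsemi> ((\<delta> C A B \<boxtimes> \<iota> D) \<Zsemi> \<delta>\<^sup># (C \<otimes> A) (C \<otimes> B) D \<Zsemi> (\<alpha>\<^sup>\<otimes> C A D \<boxplus> \<alpha>\<^sup>\<otimes> C B D))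
      \<Zsemi> (\<iota> C \<boxtimes> \<gamma>\<^sup>\<otimes> A D \<boxplus> \<iota> C \<boxtimes> \<gamma>\<^sup>\<otimes> B D)"
    by (simp add: comp_assoc tensor.comp_tail right_distrib_swap)
  also have "\<dots> = (\<gamma>\<^sup>\<otimes> (A \<oplus> B) C \<boxtimes> \<iota> D) \<Zsemi> \<alpha>\<^sup>\<otimes> C (A \<oplus> B) D \<Zsemi> (\<iota> C \<boxtimes> \<delta>\<^sup># A B D)
      \<Zsemi> (\<delta> C (A \<otimes> D) (B \<otimes> D) \<Zsemi> (\<iota> C \<boxtimes> \<gamma>\<^sup>\<otimes> A D \<boxplus> \<iota> C \<boxtimes> \<gamma>\<^sup>\<otimes> B D))"
    by (subst right_distrib_tensor_middle) (simp_all add: comp_assoc)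
  also have "\<delta> C (A \<otimes> D) (B \<otimes> D) \<Zsemi> (\<iota> C \<boxtimes> \<gamma>\<^sup>\<otimes> A D \<boxplus> \<iota> C \<boxtimes> \<gamma>\<^sup>\<otimes> B D)
      = (\<iota> C \<boxtimes> (\<gamma>\<^sup>\<otimes> A D \<boxplus> \<gamma>\<^sup>\<otimes> B D)) \<Zsemi> \<delta> C (D \<otimes> A) (D \<otimes> B)"
    by (rule distrib_nat[symmetric]) (simp_all add: hom_iff)
  also have "(\<gamma>\<^sup>\<otimes> (A \<oplus> B) C \<boxtimes> \<iota> D) \<Zsemi> \<alpha>\<^sup>\<otimes> C (A \<oplus> B) D \<Zsemi> (\<iota> C \<boxtimes> \<delta>\<^sup># A B D) \<Zsemi> \<dots>
    = ?h (A \<oplus> B) \<Zsemi> (\<iota> C \<boxtimes> \<delta> D A B) \<Zsemi> \<delta> C (D \<otimes> A) (D \<otimes> B)"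
    by (simp add: comp_assoc tensor.comp_tail right_distrib_swap)
  \<comment> \<open>The hexagon backwards, at the whole sum: the two braidings merge into one past
    \<open>C \<otimes> D\<close>, as \<open>right_distrib_swap\<close> requires.\<close>
  also have "\<dots> = (\<alpha>\<^sup>\<otimes> (A \<oplus> B) C D \<Zsemi> ?q (A \<oplus> B)) \<Zsemi> (\<iota> C \<boxtimes> \<delta> D A B) \<Zsemi> \<delta> C (D \<otimes> A) (D \<otimes> B)"
    by (subst hex) simp_all
  also have "\<dots> = \<alpha>\<^sup>\<otimes> (A \<oplus> B) C D \<Zsemi> \<gamma>\<^sup>\<otimes> (A \<oplus> B) (C \<otimes> D)
      \<Zsemi> (\<alpha>\<^sup>\<otimes> C D (A \<oplus> B) \<Zsemi> (\<iota> C \<boxtimes> \<delta> D A B) \<Zsemi> \<delta> C (D \<otimes> A) (D \<otimes> B))"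
    by (simp add: comp_assoc)
  also have "\<dots> = \<alpha>\<^sup>\<otimes> (A \<oplus> B) C D \<Zsemi> (\<gamma>\<^sup>\<otimes> (A \<oplus> B) (C \<otimes> D) \<Zsemi> \<delta> (C \<otimes> D) A B)
      \<Zsemi> (\<alpha>\<^sup>\<otimes> C D A \<boxplus> \<alpha>\<^sup>\<otimes> C D B)"
    by (subst distrib_tensor_assoc) (simp_all add: comp_assoc)
  also have "\<dots> = ?R \<Zsemi> ?g"
    by (subst right_distrib_swap[symmetric]) (simp_all add: comp_assoc sum.comp)
  finally show "?L \<Zsemi> ?g = ?R \<Zsemi> ?g" .
qed simp_all

text \<open>With \<open>\<delta>\<^sup>#\<close> unfolded, the left side is literally that of
  \<open>distrib_distrib\<close>; on the right, the inverse of a sum splits over its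
  summands.\<close>

lemma right_distrib_distrib:
  assumes [simp]: "A \<in> Obj \<C>" "B \<in> Obj \<C>" "C \<in> Obj \<C>" "D \<in> Obj \<C>"
  shows "\<delta>\<^sup># A B (C \<oplus> D) \<Zsemi> (\<delta> A C D \<boxplus> \<delta> B C D) \<Zsemi> \<sigma> A B C D
    = \<delta> (A \<oplus> B) C D \<Zsemi> (\<delta>\<^sup># A B C \<boxplus> \<delta>\<^sup># A B D)"
  unfolding right_distrib_def distrib_distrib[OF assms] by (simp add: comp_assoc sum.comp)

section \<open>Annihilators\<close>

text \<open>\<open>double_swap_zero\<close> gives a right inverse, and invertibility of the braiding
  makes it the inverse.\<close>

lemma tensor_swap_zero_inverse:
  assumes [simp]: "A \<in> Obj \<C>"
  shows "inv (\<gamma>\<^sup>\<otimes> A \<zero>) = \<gamma>\<^sup>\<otimes> \<zero> A"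
proof -
  have "inv (\<gamma>\<^sup>\<otimes> A \<zero>) \<Zsemi> (\<gamma>\<^sup>\<otimes> A \<zero> \<Zsemi> \<gamma>\<^sup>\<otimes> \<zero> A) = inv (\<gamma>\<^sup>\<otimes> A \<zero>)"
    using double_swap_zero[of A] by (simp add: double_swap_def)
  then show ?thesis by simp
qed

lemma tensor_swap_zero_cancel:
  assumes [simp]: "A \<in> Obj \<C>"
  shows "\<gamma>\<^sup>\<otimes> \<zero> A \<Zsemi> \<gamma>\<^sup>\<otimes> A \<zero> = \<iota> (\<zero> \<otimes> A)"
  by (subst tensor_swap_zero_inverse[symmetric]) simp_all

lemma left_annih_arr [simp]:
  assumes "A \<in> Obj \<C>"
  shows "\<lambda>\<^sup>* A \<in> Arr \<C>" "Dom \<C> (\<lambda>\<^sup>* A) = \<zero> \<otimes> A" "Cod \<C> (\<lambda>\<^sup>* A) = \<zero>"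
    "starts X (\<lambda>\<^sup>* A) \<longleftrightarrow> X = \<zero> \<otimes> A"
  using assms by (simp_all add: left_annih_def)

text \<open>The braiding in \<open>\<lambda>\<^sup>* (A \<oplus> B)\<close> meets the leading
  braiding of \<open>annih_sum\<close> after naming them against zero, and cancels it; the inverse
  braidings there become those of \<open>\<lambda>\<^sup>* A\<close> and
  \<open>\<lambda>\<^sup>* B\<close>.\<close>

lemma distrib_left_annih:
  assumes [simp]: "A \<in> Obj \<C>" "B \<in> Obj \<C>"
  shows "\<delta> \<zero> A B \<Zsemi> (\<lambda>\<^sup>* A \<boxplus> \<lambda>\<^sup>* B) \<Zsemi> \<lambda>\<^sup>\<oplus> \<zero> = \<lambda>\<^sup>* (A \<oplus> B)"
proof -
  have "\<lambda>\<^sup>* (A \<oplus> B) = \<gamma>\<^sup>\<otimes> \<zero> (A \<oplus> B) \<Zsemi> \<epsilon> (A \<oplus> B)"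
    by (simp add: left_annih_def)
  also have "\<dots> = \<delta> \<zero> A B \<Zsemi> (\<gamma>\<^sup>\<otimes> \<zero> A \<boxplus> \<gamma>\<^sup>\<otimes> \<zero> B) \<Zsemi> (\<epsilon> A \<boxplus> \<epsilon> B) \<Zsemi> \<lambda>\<^sup>\<oplus> \<zero>"
    by (simp add: annih_sum comp_assoc tensor_swap_zero_inverse reassoc[OF tensor_swap_zero_cancel])
  finally show ?thesis
    by (simp add: left_annih_def comp_assoc sum.comp_tail)
qed

lemma right_distrib_annih:
  assumes "A \<in> Obj \<C>" "B \<in> Obj \<C>"
  shows "\<delta>\<^sup># A B \<zero> \<Zsemi> (\<epsilon> A \<boxplus> \<epsilon> B) \<Zsemi> \<lambda>\<^sup>\<oplus> \<zero> = \<epsilon> (A \<oplus> B)"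
  unfolding right_distrib_def annih_sum[OF assms] ..

text \<open>The second hexagon brings \<open>B\<close> in front of
  \<open>A \<otimes> \<zero>\<close>, so that \<open>annih_tensor\<close> recognises the annihilator
  of \<open>B \<otimes> A\<close>.\<close>

lemma annih_left_annih:
  assumes [simp]: "A \<in> Obj \<C>" "B \<in> Obj \<C>"
  shows "(\<epsilon> A \<boxtimes> \<iota> B) \<Zsemi> \<lambda>\<^sup>* B = \<alpha>\<^sup>\<otimes> A \<zero> B \<Zsemi> (\<iota> A \<boxtimes> \<lambda>\<^sup>* B) \<Zsemi> \<epsilon> A"
proof -
  have "(\<epsilon> A \<boxtimes> \<iota> B) \<Zsemi> \<lambda>\<^sup>* B = (\<epsilon> A \<boxtimes> \<iota> B) \<Zsemi> \<gamma>\<^sup>\<otimes> \<zero> B \<Zsemi> \<epsilon> B"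
    by (simp add: left_annih_def comp_assoc)
  also have "(\<epsilon> A \<boxtimes> \<iota> B) \<Zsemi> \<gamma>\<^sup>\<otimes> \<zero> B = \<gamma>\<^sup>\<otimes> (A \<otimes> \<zero>) B \<Zsemi> (\<iota> B \<boxtimes> \<epsilon> A)"
    by (rule tensor_swap_nat) (simp_all add: hom_iff)
  also have "\<dots> \<Zsemi> \<epsilon> B = \<alpha>\<^sup>\<otimes> A \<zero> B \<Zsemi> (\<iota> A \<boxtimes> \<gamma>\<^sup>\<otimes> \<zero> B) \<Zsemi> inv (\<alpha>\<^sup>\<otimes> A B \<zero>)
      \<Zsemi> (\<gamma>\<^sup>\<otimes> A B \<boxtimes> \<iota> \<zero>) \<Zsemi> (\<alpha>\<^sup>\<otimes> B A \<zero> \<Zsemi> (\<iota> B \<boxtimes> \<epsilon> A) \<Zsemi> \<epsilon> B)"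
    by (simp add: tensor_swap_tensor_left comp_assoc)
  also have "\<dots> = \<alpha>\<^sup>\<otimes> A \<zero> B \<Zsemi> (\<iota> A \<boxtimes> \<gamma>\<^sup>\<otimes> \<zero> B) \<Zsemi> inv (\<alpha>\<^sup>\<otimes> A B \<zero>)
      \<Zsemi> ((\<gamma>\<^sup>\<otimes> A B \<boxtimes> \<iota> \<zero>) \<Zsemi> \<epsilon> (B \<otimes> A))"
    by (simp add: comp_assoc annih_tensor)
  \<comment> \<open>Naturality of \<epsilon> absorbs the leftover braiding. It also replaces
    \<open>B \<otimes> A\<close> by \<open>A \<otimes> B\<close>, whose expansion by
    \<open>annih_tensor\<close> cancels the inverse associator.\<close>
  also have "(\<gamma>\<^sup>\<otimes> A B \<boxtimes> \<iota> \<zero>) \<Zsemi> \<epsilon> (B \<otimes> A) = \<epsilon> (A \<otimes> B)"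
    by (subst annih_nat[of _ "A \<otimes> B"]) (simp_all add: hom_iff)
  finally show ?thesis
    by (simp add: annih_tensor left_annih_def comp_assoc tensor.comp_tail)
qed

text \<open>\<open>annih_left_annih\<close> lets the braidings of zero past \<open>A\<close> and
  past \<open>B\<close> meet; the first hexagon merges them into one past
  \<open>A \<otimes> B\<close>.\<close>

lemma left_annih_tensor:
  assumes [simp]: "A \<in> Obj \<C>" "B \<in> Obj \<C>"
  shows "(\<lambda>\<^sup>* A \<boxtimes> \<iota> B) \<Zsemi> \<lambda>\<^sup>* B = \<alpha>\<^sup>\<otimes> \<zero> A B \<Zsemi> \<lambda>\<^sup>* (A \<otimes> B)"
proof -
  have "(\<lambda>\<^sup>* A \<boxtimes> \<iota> B) \<Zsemi> \<lambda>\<^sup>* B = (\<gamma>\<^sup>\<otimes> \<zero> A \<boxtimes> \<iota> B) \<Zsemi> ((\<epsilon> A \<boxtimes> \<iota> B) \<Zsemi> \<lambda>\<^sup>* B)"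
    by (simp add: left_annih_def[of _ A] comp_assoc tensor.comp_tail)
  also have "\<dots> = ((\<gamma>\<^sup>\<otimes> \<zero> A \<boxtimes> \<iota> B) \<Zsemi> \<alpha>\<^sup>\<otimes> A \<zero> B \<Zsemi> (\<iota> A \<boxtimes> \<gamma>\<^sup>\<otimes> \<zero> B)) \<Zsemi> (\<iota> A \<boxtimes> \<epsilon> B) \<Zsemi> \<epsilon> A"
    by (simp add: annih_left_annih) (simp add: left_annih_def comp_assoc tensor.comp_tail)
  also have "\<dots> = \<alpha>\<^sup>\<otimes> \<zero> A B \<Zsemi> \<lambda>\<^sup>* (A \<otimes> B)"
    by (subst tensor_hexagon[symmetric]) (simp_all add: left_annih_def annih_tensor comp_assoc)
  finally show ?thesis .
qed

section \<open>Additive and multiplicative units\<close>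

text \<open>The mirror image of \<open>distrib_sum_right_unit\<close> under additive swaps;
  \<open>sum.swap_unit\<close> exchanges the unitors both outside and inside the tensor.\<close>

lemma distrib_sum_left_unit:
  assumes [simp]: "A \<in> Obj \<C>" "B \<in> Obj \<C>"
  shows "\<delta> A \<zero> B \<Zsemi> (\<epsilon> A \<boxplus> \<iota> (A \<otimes> B)) \<Zsemi> \<lambda>\<^sup>\<oplus> (A \<otimes> B) = \<iota> A \<boxtimes> \<lambda>\<^sup>\<oplus> B"
proof -
  have "\<delta> A \<zero> B \<Zsemi> (\<epsilon> A \<boxplus> \<iota> (A \<otimes> B)) \<Zsemi> \<lambda>\<^sup>\<oplus> (A \<otimes> B)
      = (\<iota> A \<boxtimes> \<gamma>\<^sup>\<oplus> \<zero> B) \<Zsemi> \<delta> A B \<zero>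
        \<Zsemi> (\<gamma>\<^sup>\<oplus> (A \<otimes> B) (A \<otimes> \<zero>) \<Zsemi> (\<epsilon> A \<boxplus> \<iota> (A \<otimes> B))) \<Zsemi> \<lambda>\<^sup>\<oplus> (A \<otimes> B)"
    by (subst distrib_sum_swap) (simp_all add: comp_assoc)
  also have "\<gamma>\<^sup>\<oplus> (A \<otimes> B) (A \<otimes> \<zero>) \<Zsemi> (\<epsilon> A \<boxplus> \<iota> (A \<otimes> B))
      = (\<iota> (A \<otimes> B) \<boxplus> \<epsilon> A) \<Zsemi> \<gamma>\<^sup>\<oplus> (A \<otimes> B) \<zero>"
    by (rule sum_swap_nat[symmetric]) (simp_all add: hom_iff)
  also have "(\<iota> A \<boxtimes> \<gamma>\<^sup>\<oplus> \<zero> B) \<Zsemi> \<delta> A B \<zero> \<Zsemi> \<dots> \<Zsemi> \<lambda>\<^sup>\<oplus> (A \<otimes> B)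
      = (\<iota> A \<boxtimes> \<gamma>\<^sup>\<oplus> \<zero> B) \<Zsemi> (\<delta> A B \<zero> \<Zsemi> (\<iota> (A \<otimes> B) \<boxplus> \<epsilon> A) \<Zsemi> \<rho>\<^sup>\<oplus> (A \<otimes> B))"
    by (simp add: comp_assoc sum.swap_unit)
  also have "\<dots> = (\<iota> A \<boxtimes> \<gamma>\<^sup>\<oplus> \<zero> B) \<Zsemi> (\<iota> A \<boxtimes> \<gamma>\<^sup>\<oplus> B \<zero> \<Zsemi> (\<iota> A \<boxtimes> \<lambda>\<^sup>\<oplus> B))"
    by (simp add: distrib_sum_right_unit sum.swap_unit tensor.comp)
  also have "\<dots> = \<iota> A \<boxtimes> \<lambda>\<^sup>\<oplus> B"
    by (simp add: tensor.comp reassoc[OF sum_symmetry])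
  finally show ?thesis .
qed

text \<open>\<open>\<lambda>\<^sup>* A\<close> already begins with a braiding, so postcomposing with
  one braiding of \<open>B\<close> past \<open>A\<close> completes the sum of braidings in
  \<open>right_distrib_swap\<close> and leaves \<open>distrib_sum_left_unit\<close>.\<close>

lemma right_distrib_sum_left_unit:
  assumes [simp]: "A \<in> Obj \<C>" "B \<in> Obj \<C>"
  shows "\<delta>\<^sup># \<zero> B A \<Zsemi> (\<lambda>\<^sup>* A \<boxplus> \<iota> (B \<otimes> A)) \<Zsemi> \<lambda>\<^sup>\<oplus> (B \<otimes> A) = \<lambda>\<^sup>\<oplus> B \<boxtimes> \<iota> A"
proof (rule iso_cancel_right)
  show "is_iso (\<gamma>\<^sup>\<otimes> B A)" by simp
  have "\<delta>\<^sup># \<zero> B A \<Zsemi> (\<lambda>\<^sup>* A \<boxplus> \<iota> (B \<otimes> A)) \<Zsemi> \<lambda>\<^sup>\<oplus> (B \<otimes> A) \<Zsemi> \<gamma>\<^sup>\<otimes> B A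
      = \<delta>\<^sup># \<zero> B A \<Zsemi> (\<lambda>\<^sup>* A \<boxplus> \<iota> (B \<otimes> A)) \<Zsemi> ((\<iota> \<zero> \<boxplus> \<gamma>\<^sup>\<otimes> B A) \<Zsemi> \<lambda>\<^sup>\<oplus> (A \<otimes> B))"
    by (simp add: sum_left_unit_nat[of _ "B \<otimes> A"] hom_iff comp_assoc)
  also have "\<dots> = (\<delta>\<^sup># \<zero> B A \<Zsemi> (\<gamma>\<^sup>\<otimes> \<zero> A \<boxplus> \<gamma>\<^sup>\<otimes> B A)) \<Zsemi> (\<epsilon> A \<boxplus> \<iota> (A \<otimes> B)) \<Zsemi> \<lambda>\<^sup>\<oplus> (A \<otimes> B)"
    by (simp add: left_annih_def comp_assoc sum.comp_tail)
  also have "\<dots> = \<gamma>\<^sup>\<otimes> (\<zero> \<oplus> B) A \<Zsemi> (\<delta> A \<zero> B \<Zsemi> (\<epsilon> A \<boxplus> \<iota> (A \<otimes> B)) \<Zsemi> \<lambda>\<^sup>\<oplus> (A \<otimes> B))"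
    by (simp add: right_distrib_swap comp_assoc)
  also have "\<dots> = \<gamma>\<^sup>\<otimes> (\<zero> \<oplus> B) A \<Zsemi> (\<iota> A \<boxtimes> \<lambda>\<^sup>\<oplus> B)"
    by (simp only: distrib_sum_left_unit assms)
  also have "\<dots> = (\<lambda>\<^sup>\<oplus> B \<boxtimes> \<iota> A) \<Zsemi> \<gamma>\<^sup>\<otimes> B A"
    by (rule tensor_swap_nat[symmetric]) (simp_all add: hom_iff)
  finally show "\<delta>\<^sup># \<zero> B A \<Zsemi> (\<lambda>\<^sup>* A \<boxplus> \<iota> (B \<otimes> A)) \<Zsemi> \<lambda>\<^sup>\<oplus> (B \<otimes> A) \<Zsemi> \<gamma>\<^sup>\<otimes> B A
    = (\<lambda>\<^sup>\<oplus> B \<boxtimes> \<iota> A) \<Zsemi> \<gamma>\<^sup>\<otimes> B A" .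
qed simp_all

lemma right_distrib_sum_right_unit:
  assumes [simp]: "A \<in> Obj \<C>" "B \<in> Obj \<C>"
  shows "\<delta>\<^sup># A \<zero> B \<Zsemi> (\<iota> (A \<otimes> B) \<boxplus> \<lambda>\<^sup>* B) \<Zsemi> \<rho>\<^sup>\<oplus> (A \<otimes> B) = \<rho>\<^sup>\<oplus> A \<boxtimes> \<iota> B"
proof (rule iso_cancel_right)
  show "is_iso (\<gamma>\<^sup>\<otimes> A B)" by simp
  have "\<delta>\<^sup># A \<zero> B \<Zsemi> (\<iota> (A \<otimes> B) \<boxplus> \<lambda>\<^sup>* B) \<Zsemi> \<rho>\<^sup>\<oplus> (A \<otimes> B) \<Zsemi> \<gamma>\<^sup>\<otimes> A B
      = \<delta>\<^sup># A \<zero> B \<Zsemi> (\<iota> (A \<otimes> B) \<boxplus> \<lambda>\<^sup>* B) \<Zsemi> ((\<gamma>\<^sup>\<otimes> A B \<boxplus> \<iota> \<zero>) \<Zsemi> \<rho>\<^sup>\<oplus> (B \<otimes> A))"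
    by (simp add: sum_right_unit_nat[of _ "A \<otimes> B"] hom_iff comp_assoc)
  also have "\<dots> = (\<delta>\<^sup># A \<zero> B \<Zsemi> (\<gamma>\<^sup>\<otimes> A B \<boxplus> \<gamma>\<^sup>\<otimes> \<zero> B)) \<Zsemi> (\<iota> (B \<otimes> A) \<boxplus> \<epsilon> B) \<Zsemi> \<rho>\<^sup>\<oplus> (B \<otimes> A)"
    by (simp add: left_annih_def comp_assoc sum.comp_tail)
  also have "\<dots> = \<gamma>\<^sup>\<otimes> (A \<oplus> \<zero>) B \<Zsemi> (\<delta> B A \<zero> \<Zsemi> (\<iota> (B \<otimes> A) \<boxplus> \<epsilon> B) \<Zsemi> \<rho>\<^sup>\<oplus> (B \<otimes> A))"
    by (simp add: right_distrib_swap comp_assoc)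
  also have "\<dots> = \<gamma>\<^sup>\<otimes> (A \<oplus> \<zero>) B \<Zsemi> (\<iota> B \<boxtimes> \<rho>\<^sup>\<oplus> A)"
    by (simp only: distrib_sum_right_unit assms)
  also have "\<dots> = (\<rho>\<^sup>\<oplus> A \<boxtimes> \<iota> B) \<Zsemi> \<gamma>\<^sup>\<otimes> A B"
    by (rule tensor_swap_nat[symmetric]) (simp_all add: hom_iff)
  finally show "\<delta>\<^sup># A \<zero> B \<Zsemi> (\<iota> (A \<otimes> B) \<boxplus> \<lambda>\<^sup>* B) \<Zsemi> \<rho>\<^sup>\<oplus> (A \<otimes> B) \<Zsemi> \<gamma>\<^sup>\<otimes> A B
    = (\<rho>\<^sup>\<oplus> A \<boxtimes> \<iota> B) \<Zsemi> \<gamma>\<^sup>\<otimes> A B" .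
qed simp_all

text \<open>Each right unitor is a braiding followed by a left unitor, so the braidings clear the
  inverses in \<open>\<delta>\<^sup>#\<close> and \<open>distrib_one\<close> applies.\<close>

lemma right_distrib_one:
  assumes [simp]: "A \<in> Obj \<C>" "B \<in> Obj \<C>"
  shows "\<delta>\<^sup># A B \<one> \<Zsemi> (\<rho>\<^sup>\<otimes> A \<boxplus> \<rho>\<^sup>\<otimes> B) = \<rho>\<^sup>\<otimes> (A \<oplus> B)"
proof -
  have "\<delta>\<^sup># A B \<one> \<Zsemi> (\<rho>\<^sup>\<otimes> A \<boxplus> \<rho>\<^sup>\<otimes> B) = \<delta>\<^sup># A B \<one> \<Zsemi> (\<gamma>\<^sup>\<otimes> A \<one> \<boxplus> \<gamma>\<^sup>\<otimes> B \<one>) \<Zsemi> (\<lambda>\<^sup>\<otimes> A \<boxplus> \<lambda>\<^sup>\<otimes> B)"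
    by (simp add: comp_assoc sum.comp tensor.swap_unit)
  also have "\<dots> = \<gamma>\<^sup>\<otimes> (A \<oplus> B) \<one> \<Zsemi> \<lambda>\<^sup>\<otimes> (A \<oplus> B)"
    by (simp add: right_distrib_swap comp_assoc distrib_one)
  finally show ?thesis by (simp add: tensor.swap_unit)
qed

end

theorem theorem10:
  fixes \<C> :: "('o, 'm, 'x) bd_cat_scheme" (structure)
  assumes "bd_category \<C>"
    and "A \<in> Obj \<C>" "B \<in> Obj \<C>" "C \<in> Obj \<C>" "D \<in> Obj \<C>"
  shows
    "(\<delta> A B C = (\<iota> A \<boxtimes> \<gamma>\<^sup>\<oplus> B C) \<Zsemi> \<delta> A C B \<Zsemi> \<gamma>\<^sup>\<oplus> (A \<otimes> C) (A \<otimes> B)) \<and>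
     (\<delta>\<^sup># A B C \<Zsemi> (\<gamma>\<^sup>\<otimes> A C \<boxplus> \<gamma>\<^sup>\<otimes> B C) = \<gamma>\<^sup>\<otimes> (A \<oplus> B) C \<Zsemi> \<delta> C A B) \<and>
     (\<delta>\<^sup># A B C \<Zsemi> \<gamma>\<^sup>\<oplus> (A \<otimes> C) (B \<otimes> C) = (\<gamma>\<^sup>\<oplus> A B \<boxtimes> \<iota> C) \<Zsemi> \<delta>\<^sup># B A C) \<and>
     ((\<alpha>\<^sup>\<oplus> A B C \<boxtimes> \<iota> D) \<Zsemi> \<delta>\<^sup># A (B \<oplus> C) D \<Zsemi> (\<iota> (A \<otimes> D) \<boxplus> \<delta>\<^sup># B C D)
       = \<delta>\<^sup># (A \<oplus> B) C D \<Zsemi> (\<delta>\<^sup># A B D \<boxplus> \<iota> (C \<otimes> D)) \<Zsemi> \<alpha>\<^sup>\<oplus> (A \<otimes> D) (B \<otimes> D) (C \<otimes> D)) \<and>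
     ((\<iota> A \<boxtimes> \<alpha>\<^sup>\<oplus> B C D) \<Zsemi> \<delta> A B (C \<oplus> D) \<Zsemi> (\<iota> (A \<otimes> B) \<boxplus> \<delta> A C D)
       = \<delta> A (B \<oplus> C) D \<Zsemi> (\<delta> A B C \<boxplus> \<iota> (A \<otimes> D)) \<Zsemi> \<alpha>\<^sup>\<oplus> (A \<otimes> B) (A \<otimes> C) (A \<otimes> D)) \<and>
     (\<alpha>\<^sup>\<otimes> A B (C \<oplus> D) \<Zsemi> (\<iota> A \<boxtimes> \<delta> B C D) \<Zsemi> \<delta> A (B \<otimes> C) (B \<otimes> D)
       = \<delta> (A \<otimes> B) C D \<Zsemi> (\<alpha>\<^sup>\<otimes> A B C \<boxplus> \<alpha>\<^sup>\<otimes> A B D)) \<and>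
     ((\<delta>\<^sup># A B C \<boxtimes> \<iota> D) \<Zsemi> \<delta>\<^sup># (A \<otimes> C) (B \<otimes> C) D \<Zsemi> (\<alpha>\<^sup>\<otimes> A C D \<boxplus> \<alpha>\<^sup>\<otimes> B C D)
       = \<alpha>\<^sup>\<otimes> (A \<oplus> B) C D \<Zsemi> \<delta>\<^sup># A B (C \<otimes> D)) \<and>
     ((\<delta> A B C \<boxtimes> \<iota> D) \<Zsemi> \<delta>\<^sup># (A \<otimes> B) (A \<otimes> C) D \<Zsemi> (\<alpha>\<^sup>\<otimes> A B D \<boxplus> \<alpha>\<^sup>\<otimes> A C D)
       = \<alpha>\<^sup>\<otimes> A (B \<oplus> C) D \<Zsemi> (\<iota> A \<boxtimes> \<delta>\<^sup># B C D) \<Zsemi> \<delta> A (B \<otimes> D) (C \<otimes> D)) \<and>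
     (\<delta>\<^sup># A B (C \<oplus> D) \<Zsemi> (\<delta> A C D \<boxplus> \<delta> B C D) \<Zsemi> \<sigma> A B C D
       = \<delta> (A \<oplus> B) C D \<Zsemi> (\<delta>\<^sup># A B C \<boxplus> \<delta>\<^sup># A B D)) \<and>
     (\<lambda>\<^sup>* \<zero> = \<rho>\<^sup>* \<zero>) \<and>
     (\<delta> \<zero> A B \<Zsemi> (\<lambda>\<^sup>* A \<boxplus> \<lambda>\<^sup>* B) \<Zsemi> \<lambda>\<^sup>\<oplus> \<zero> = \<lambda>\<^sup>* (A \<oplus> B)) \<and>
     (\<delta>\<^sup># A B \<zero> \<Zsemi> (\<rho>\<^sup>* A \<boxplus> \<rho>\<^sup>* B) \<Zsemi> \<lambda>\<^sup>\<oplus> \<zero> = \<rho>\<^sup>* (A \<oplus> B)) \<and>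
     (\<rho>\<^sup>\<otimes> \<zero> = \<lambda>\<^sup>* \<one>) \<and>
     (\<lambda>\<^sup>\<otimes> \<zero> = \<rho>\<^sup>* \<one>) \<and>
     (\<lambda>\<^sup>* A = \<gamma>\<^sup>\<otimes> \<zero> A \<Zsemi> \<rho>\<^sup>* A) \<and>
     ((\<lambda>\<^sup>* A \<boxtimes> \<iota> B) \<Zsemi> \<lambda>\<^sup>* B = \<alpha>\<^sup>\<otimes> \<zero> A B \<Zsemi> \<lambda>\<^sup>* (A \<otimes> B)) \<and>
     ((\<rho>\<^sup>* A \<boxtimes> \<iota> B) \<Zsemi> \<lambda>\<^sup>* B = \<alpha>\<^sup>\<otimes> A \<zero> B \<Zsemi> (\<iota> A \<boxtimes> \<lambda>\<^sup>* B) \<Zsemi> \<rho>\<^sup>* A) \<and>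
     (\<rho>\<^sup>* (A \<otimes> B) = \<alpha>\<^sup>\<otimes> A B \<zero> \<Zsemi> (\<iota> A \<boxtimes> \<rho>\<^sup>* B) \<Zsemi> \<rho>\<^sup>* A) \<and>
     (\<delta> A \<zero> B \<Zsemi> (\<rho>\<^sup>* A \<boxplus> \<iota> (A \<otimes> B)) \<Zsemi> \<lambda>\<^sup>\<oplus> (A \<otimes> B) = \<iota> A \<boxtimes> \<lambda>\<^sup>\<oplus> B) \<and>
     (\<delta>\<^sup># \<zero> B A \<Zsemi> (\<lambda>\<^sup>* A \<boxplus> \<iota> (B \<otimes> A)) \<Zsemi> \<lambda>\<^sup>\<oplus> (B \<otimes> A) = \<lambda>\<^sup>\<oplus> B \<boxtimes> \<iota> A) \<and>
     (\<delta> A B \<zero> \<Zsemi> (\<iota> (A \<otimes> B) \<boxplus> \<rho>\<^sup>* A) \<Zsemi> \<rho>\<^sup>\<oplus> (A \<otimes> B) = \<iota> A \<boxtimes> \<rho>\<^sup>\<oplus> B) \<and>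
     (\<delta>\<^sup># A \<zero> B \<Zsemi> (\<iota> (A \<otimes> B) \<boxplus> \<lambda>\<^sup>* B) \<Zsemi> \<rho>\<^sup>\<oplus> (A \<otimes> B) = \<rho>\<^sup>\<oplus> A \<boxtimes> \<iota> B) \<and>
     (\<delta> \<one> A B \<Zsemi> (\<lambda>\<^sup>\<otimes> A \<boxplus> \<lambda>\<^sup>\<otimes> B) = \<lambda>\<^sup>\<otimes> (A \<oplus> B)) \<and>
     (\<delta>\<^sup># A B \<one> \<Zsemi> (\<rho>\<^sup>\<otimes> A \<boxplus> \<rho>\<^sup>\<otimes> B) = \<rho>\<^sup>\<otimes> (A \<oplus> B))"
proof -
  interpret bd_category \<C> by fact
  show ?thesis
    unfolding right_annih_def
    using assms(2-5)
    by (intro conjI distrib_sum_swap right_distrib_swap right_distrib_sum_swap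
        right_distrib_sum_assoc distrib_sum_assoc distrib_tensor_assoc right_distrib_tensor_assoc
        right_distrib_tensor_middle right_distrib_distrib distrib_left_annih right_distrib_annih
        annih_one[symmetric] left_annih_def left_annih_tensor annih_left_annih annih_tensor
        distrib_sum_left_unit right_distrib_sum_left_unit distrib_sum_right_unit
        right_distrib_sum_right_unit distrib_one right_distrib_one)
      \<comment> \<open>Besides object memberships, two conditions are left: at zero the braiding is
        trivial, and at one \<open>annih_one\<close> with \<open>tensor.swap_unit\<close> yields the
        right unitor of zero.\<close>
      (simp_all add: left_annih_def tensor_swap_zero annih_one tensor.swap_unit)
qed

end
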